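(* Let $A\in\mathbb{R}^{n\times n}$ be symmetric, $b\in\mathbb{R}^n$, and for $k=1,\ldots,m$ let $F^k\in\mathbb{R}^{r^k\times n}$ and $g^k\in\mathbb{R}^{r^k}$ with $r^k\ge 1$. Let (ECQP) be the problem of minimizing $f(x)=x^TAx+2b^Tx$ over $x\in\mathbb{R}^n$ subject to $\|F^kx+g^k\|^2\le 1$, $k=1,\ldots,m$, and let (SDP) be its semidefinite relaxation (defined in the context), with optimal value $v({\rm SDP})$. Assume that $\|g^k\|<1$ for $k=1,\ldots,m$, and that (SDP) has an optimal solution. Then the point $x=\overline{\tau}\,\overline{x}$ produced by the construction described in the context is feasible for (ECQP) and satisfies \[ f(x)\le \frac{(1-\gamma)^2}{\left(\sqrt{\widetilde{r}}+\gamma\right)^2}\cdot v({\rm SDP}), \] where $\gamma=\max_{k=1,\ldots,m}\|g^k\|$, $\widetilde{r}=\min\{r_0,n+1\}$ and $r_0=\left\lceil\frac{\sqrt{8m+17}-3}{2}\right\rceil$.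
   Context: Here $\|\cdot\|$ is the Euclidean norm, $P\bullet Q=\sum_{i,j}P_{ij}Q_{ij}$ for matrices of the same size, and $X\succeq 0$ means that $X$ is symmetric positive semidefinite. Semidefinite relaxation. Put \[ B=\begin{bmatrix}A& b\\ b^T& 0\end{bmatrix},\qquad B^k=\begin{bmatrix}(F^k)^TF^k& (F^k)^Tg^k\\ (g^k)^TF^k& \|g^k\|^2-1\end{bmatrix},\quad k=1,\ldots,m. \] (SDP) is the problem of minimizing $B\bullet X$ over $X\in\mathbb{R}^{(n+1)\times(n+1)}$ subject to $B^k\bullet X\le 0$ for $k=1,\ldots,m$, $X_{n+1,n+1}=1$, $X\succeq 0$. Its optimal value is denoted $v({\rm SDP})$. Construction. 1. Let $X^*$ be an optimal solution of (SDP) whose rank $r$ satisfies $r\le r_0=\left\lceil\frac{\sqrt{8m+17}-3}{2}\right\rceil$. (Known result: if (SDP) is solvable and $s$ is a positive integer with $m+1\le (s+2)(s+1)/2-1$, equivalently $s\ge r_0$, then (SDP) has an optimal solution of rank at most $s$.) 2. Let $B^*=\begin{bmatrix}A& b\\ b^T& -v({\rm SDP})\end{bmatrix}$, so that $B^*\bullet X^*=0$. Choose vectors $w_i=(u_i^T,t_i)^T\in\mathbb{R}^n\times\mathbb{R}$, $i=1,\ldots,r$, such that $X^*=\sum_{i=1}^r w_iw_i^T$ and $w_i^TB^*w_i\le 0$ for $i=1,\ldots,r$. (Known result: for a positive semidefinite matrix $X$ of rank $r$ and a symmetric matrix $C$, $C\bullet X\le 0$ if and only if there is a decomposition $X=\sum_{i=1}^r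 w_iw_i^T$ with $w_i^TCw_i\le 0$ for all $i$.) 3. Choose an index $\overline{i}\in\{1,\ldots,r\}$ with $t_{\overline{i}}\neq 0$ such that $\|F^ku_{\overline{i}}/t_{\overline{i}}+g^k\|\le\sqrt{r}$ for all $k=1,\ldots,m$ (such an index exists). 4. Set $\overline{x}:=u_{\overline{i}}/t_{\overline{i}}$ if $b^Tu_{\overline{i}}/t_{\overline{i}}\le 0$, and $\overline{x}:=-u_{\overline{i}}/t_{\overline{i}}$ otherwise. 5. Set $\overline{\tau}:=\max\{\tau\in[0,1]:\ \|\tau F^k\overline{x}+g^k\|^2\le 1,\ k=1,\ldots,m\}$. *)

theory Defs
  imports Complex_Main "Jordan_Normal_Form.DL_Rank"
begin

definition vnorm :: "real vec \<Rightarrow> real" where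
  "vnorm v = sqrt (v \<bullet> v)"

definition mat_inner :: "real mat \<Rightarrow> real mat \<Rightarrow> real" where
  "mat_inner P Q = (\<Sum>i<dim_row P. \<Sum>j<dim_col P. P $$ (i, j) * Q $$ (i, j))"

definition psd :: "nat \<Rightarrow> real mat \<Rightarrow> bool" where
  "psd N X \<longleftrightarrow> X \<in> carrier_mat N N \<and> transpose_mat X = X
     \<and> (\<forall>v \<in> carrier_vec N. 0 \<le> v \<bullet> (X *\<^sub>v v))"

text \<open>The symmetric block matrix with rows \<open>(M, v)\<close> and \<open>(v\<^sup>T, c)\<close>.\<close>

definition bordered :: "real mat \<Rightarrow> real vec \<Rightarrow> real \<Rightarrow> real mat" where
  "bordered M v c = four_block_mat M (mat_of_cols (dim_vec v) [v])
     (mat_of_rows (dim_vec v) [v]) (mat 1 1 (\<lambda>_. c))"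

text \<open>
  The data of the problem are \<open>A\<close>, \<open>b\<close> and the families \<open>F\<close>, \<open>g\<close>, of which only the
  members with index in \<open>{1..m}\<close> matter. The row dimension of \<open>F k\<close> may depend on \<open>k\<close>.
\<close>

definition ecqp_obj :: "real mat \<Rightarrow> real vec \<Rightarrow> real vec \<Rightarrow> real" where
  "ecqp_obj A b x = x \<bullet> (A *\<^sub>v x) + 2 * (b \<bullet> x)"

definition ecqp_feasible ::
  "nat \<Rightarrow> nat \<Rightarrow> (nat \<Rightarrow> real mat) \<Rightarrow> (nat \<Rightarrow> real vec) \<Rightarrow> real vec \<Rightarrow> bool" where
  "ecqp_feasible n m F g x \<longleftrightarrow>
     x \<in> carrier_vec n \<and> (\<forall>k \<in> {1..m}. (vnorm (F k *\<^sub>v x + g k))\<^sup>2 \<le> 1)"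

definition constraint_mat :: "real mat \<Rightarrow> real vec \<Rightarrow> real mat" where
  "constraint_mat Fk gk = bordered (transpose_mat Fk * Fk) (transpose_mat Fk *\<^sub>v gk) ((vnorm gk)\<^sup>2 - 1)"

text \<open>Indices start at 0, so \<open>X $$ (n, n)\<close> is the bottom right entry of \<open>X\<close>.\<close>

definition sdp_feasible ::
  "nat \<Rightarrow> nat \<Rightarrow> (nat \<Rightarrow> real mat) \<Rightarrow> (nat \<Rightarrow> real vec) \<Rightarrow> real mat \<Rightarrow> bool" where
  "sdp_feasible n m F g X \<longleftrightarrow>
     psd (n + 1) X \<and> X $$ (n, n) = 1
     \<and> (\<forall>k \<in> {1..m}. mat_inner (constraint_mat (F k) (g k)) X \<le> 0)"

definition sdp_obj :: "real mat \<Rightarrow> real vec \<Rightarrow> real mat \<Rightarrow> real" where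
  "sdp_obj A b X = mat_inner (bordered A b 0) X"

definition sdp_optimal ::
  "nat \<Rightarrow> nat \<Rightarrow> real mat \<Rightarrow> real vec \<Rightarrow> (nat \<Rightarrow> real mat) \<Rightarrow> (nat \<Rightarrow> real vec) \<Rightarrow> real mat \<Rightarrow> bool" where
  "sdp_optimal n m A b F g X \<longleftrightarrow>
     sdp_feasible n m F g X \<and> (\<forall>Y. sdp_feasible n m F g Y \<longrightarrow> sdp_obj A b X \<le> sdp_obj A b Y)"

text \<open>
  This real infimum is meaningful only when the feasible set is nonempty and the objective is
  bounded below on it, as is the case when an optimal solution exists.
\<close>

definition sdp_value ::
  "nat \<Rightarrow> nat \<Rightarrow> real mat \<Rightarrow> real vec \<Rightarrow> (nat \<Rightarrow> real mat) \<Rightarrow> (nat \<Rightarrow> real vec) \<Rightarrow> real" where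
  "sdp_value n m A b F g = Inf {sdp_obj A b X | X. sdp_feasible n m F g X}"

definition rank_bound :: "nat \<Rightarrow> nat" where
  "rank_bound m = nat \<lceil>(sqrt (8 * real m + 17) - 3) / 2\<rceil>"

text \<open>
  \<open>construction n m A b F g X u t i xbar tau\<close> says that the listed data arise from one run of the
  rounding procedure: \<open>X\<close> is a low-rank optimal solution of the relaxation, the vectors
  \<open>w j = (u j, t j)\<close> form a rank-one decomposition of \<open>X\<close> (stated entrywise), \<open>i\<close> is the selected
  index, \<open>xbar\<close> is the direction and \<open>tau\<close> the maximal step. The point produced is
  \<open>tau \<cdot>\<^sub>v xbar\<close>.
\<close>

definition construction ::
  "nat \<Rightarrow> nat \<Rightarrow> real mat \<Rightarrow> real vec \<Rightarrow> (nat \<Rightarrow> real mat) \<Rightarrow> (nat \<Rightarrow> real vec)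
    \<Rightarrow> real mat \<Rightarrow> (nat \<Rightarrow> real vec) \<Rightarrow> (nat \<Rightarrow> real) \<Rightarrow> nat \<Rightarrow> real vec \<Rightarrow> real \<Rightarrow> bool" where
  "construction n m A b F g X u t i xbar tau \<longleftrightarrow>
     (let r = vec_space.rank (n + 1) X;
          w = (\<lambda>j. u j @\<^sub>v vec 1 (\<lambda>_. t j));
          Bstar = bordered A b (- sdp_value n m A b F g);
          z = (1 / t i) \<cdot>\<^sub>v u i;
          T = {\<tau> \<in> {0..1}. \<forall>k \<in> {1..m}. (vnorm (\<tau> \<cdot>\<^sub>v (F k *\<^sub>v xbar) + g k))\<^sup>2 \<le> 1}
      in sdp_optimal n m A b F g X \<and> r \<le> rank_bound m
       \<and> (\<forall>j \<in> {1..r}. u j \<in> carrier_vec n)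
       \<and> X = mat (n + 1) (n + 1) (\<lambda>(p, q). \<Sum>j = 1..r. w j $ p * w j $ q)
       \<and> (\<forall>j \<in> {1..r}. w j \<bullet> (Bstar *\<^sub>v w j) \<le> 0)
       \<and> i \<in> {1..r} \<and> t i \<noteq> 0
       \<and> (\<forall>k \<in> {1..m}. vnorm (F k *\<^sub>v z + g k) \<le> sqrt (real r))
       \<and> xbar = (if b \<bullet> z \<le> 0 then z else - z)
       \<and> tau \<in> T \<and> (\<forall>\<tau> \<in> T. \<tau> \<le> tau))"

end

theory Submission
  imports Defs "HOL-Analysis.L2_Norm"
begin

text \<open>
  The rounding procedure needs three classical facts about semidefinite programs, all of which are
  proved here: an optimal solution of small rank exists, a positive semidefinite matrix \<open>X\<close> with
  \<open>C \<bullet> X \<le> 0\<close> is a sum of \<open>rank X\<close> matrices \<open>w w\<^sup>T\<close> with \<open>w\<^sup>T C w \<le> 0\<close>, and one vector of such a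
  decomposition is nearly feasible after scaling.

  Low rank (\<open>psd_rank_reduction\<close>, \<open>sdp_low_rank_optimal\<close>). If \<open>X = W W\<^sup>T\<close> has rank \<open>r\<close> and there are fewer
  than \<open>r (r + 1) / 2\<close> linear constraints, then a symmetric \<open>E \<noteq> 0\<close> of size \<open>r\<close> exists such that
  \<open>W (1 + t E) W\<^sup>T\<close> satisfies the constraints with the same values for all \<open>t\<close>. At an optimal \<open>X\<close> the objective is constant
  along this line too. Following the line until \<open>1 + t E\<close> becomes singular keeps optimality and
  lowers the rank. With the \<open>m + 1\<close> constraints at hand this stops only at rank at most \<open>rank_bound m\<close>.

  Balanced decomposition (\<open>psd_rank_gram\<close>, \<open>gram_balanced\<close>). A decomposition into \<open>rank X\<close> vectors comes
  from a Cholesky factorization of a principal submatrix. A pair of vectors on which the form of \<open>C\<close> has opposite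
  signs can be rotated so that one of the two values becomes zero.

  Rounding (\<open>construction_exists\<close>, \<open>construction_bound\<close>). With \<open>w\<^sub>j = (u\<^sub>j, t\<^sub>j)\<close>, feasibility of \<open>X\<close> says
  \<open>\<Sum>\<^sub>j t\<^sub>j\<^sup>2 = 1\<close> and \<open>\<Sum>\<^sub>j \<parallel>F\<^sup>k u\<^sub>j + t\<^sub>j g\<^sup>k\<parallel>\<^sup>2 \<le> 1\<close>, so an index with \<open>t\<^sub>i\<^sup>2 \<ge> 1 / r\<close> gives a point
  \<open>z = u\<^sub>i / t\<^sub>i\<close> with \<open>\<parallel>F\<^sup>k z + g\<^sup>k\<parallel> \<le> sqrt r\<close>, and balancing with respect to \<open>B\<^sup>*\<close> gives
  \<open>f z \<le> v\<close>, where \<open>v \<le> 0\<close> is the optimal value. After the sign choice the linear term is nonpositive, so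
  shrinking by \<open>\<tau> \<le> 1\<close> yields \<open>f (\<tau> xbar) \<le> \<tau>\<^sup>2 v\<close>. The triangle inequality shows that
  \<open>\<tau> = (1 - \<gamma>) / (sqrt rt + \<gamma>)\<close> is an admissible step, and the maximal step is at least as large.
\<close>

section \<open>Positive semidefinite matrices as sums of rank-one matrices\<close>

text \<open>
  The dimension is an explicit argument so that the empty sum is the zero matrix of the right size.
\<close>
definition gram :: "nat \<Rightarrow> nat set \<Rightarrow> (nat \<Rightarrow> real vec) \<Rightarrow> real mat" where
  "gram N J w = mat N N (\<lambda>(p, q). \<Sum>j\<in>J. w j $ p * w j $ q)"

lemma gram_carrier [simp]: "gram N J w \<in> carrier_mat N N"
  by (simp add: gram_def)

text \<open>
  Cholesky factorization by induction on the dimension. With \<open>c\<close> the last diagonal entry and \<open>h\<close> the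
  last column, either \<open>c = 0\<close>, which forces \<open>h = 0\<close>, or the Schur complement with respect to \<open>c\<close>
  is again nonnegative and \<open>h / sqrt c\<close> is split off as the last vector.
\<close>
lemma nonneg_form_gram:
  fixes Z :: "nat \<Rightarrow> nat \<Rightarrow> real"
  assumes "\<And>p q. p < N \<Longrightarrow> q < N \<Longrightarrow> Z p q = Z q p"
    and "\<And>x. 0 \<le> (\<Sum>p<N. \<Sum>q<N. Z p q * x p * x q)"
  shows "\<exists>y. \<forall>p<N. \<forall>q<N. Z p q = (\<Sum>l<N. y l p * y l q)"
  using assms
proof (induction N arbitrary: Z)
  case 0
  then show ?case by simp
next
  case (Suc N)
  define c where "c = Z N N"
  define h where "h p = Z p N" for p
  have form: "(\<Sum>p<Suc N. \<Sum>q<Suc N. Z p q * x p * x q)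
      = (\<Sum>p<N. \<Sum>q<N. Z p q * x p * x q) + 2 * x N * (\<Sum>p<N. h p * x p) + c * (x N)\<^sup>2" for x
  proof -
    have "(\<Sum>q<N. Z N q * x N * x q) = x N * (\<Sum>p<N. h p * x p)"
      unfolding sum_distrib_left h_def using Suc.prems(1)[of N]
      by (intro sum.cong) (auto simp: algebra_simps)
    moreover have "(\<Sum>p<N. Z p N * x p * x N) = x N * (\<Sum>p<N. h p * x p)"
      unfolding sum_distrib_left h_def by (intro sum.cong) (auto simp: algebra_simps)
    ultimately show ?thesis
      by (simp add: sum.distrib c_def power2_eq_square algebra_simps)
  qed
  have nonneg: "0 \<le> (\<Sum>p<N. \<Sum>q<N. Z p q * x p * x q) + 2 * s * (\<Sum>p<N. h p * x p) + c * s\<^sup>2" for x s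
  proof -
    have "0 \<le> (\<Sum>p<Suc N. \<Sum>q<Suc N. Z p q * (x(N := s)) p * (x(N := s)) q)"
      using Suc.prems(2) by blast
    then show ?thesis unfolding form by simp
  qed
  have c0: "0 \<le> c" using nonneg[of "\<lambda>_. 0" 1] by simp
  show ?case
  proof (cases "c = 0")
    case True
    have h0: "h p = 0" if p: "p < N" for p
    proof (rule ccontr)
      assume hp: "h p \<noteq> 0"
      define e where "e = (\<lambda>k. if k = p then 1 else 0 :: real)"
      have *: "(\<Sum>k<N. f k * e k) = f p" for f
        using p by (simp add: e_def if_distrib cong: if_cong)
      have **: "(\<Sum>k<N. \<Sum>l<N. Z k l * e k * e l) = Z p p" by (simp only: *)
      \<comment> \<open>With \<open>c = 0\<close> the form is affine in the last coordinate, and this value makes it \<open>-1\<close>.\<close>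
      show False
        using nonneg[of e "- (Z p p + 1) / (2 * h p)"] hp True unfolding * ** by (simp add: field_simps)
    qed
    have "\<exists>y. \<forall>p<N. \<forall>q<N. Z p q = (\<Sum>l<N. y l p * y l q)"
    proof (intro Suc.IH)
      show "Z p q = Z q p" if "p < N" "q < N" for p q
        using that by (intro Suc.prems(1)) auto
      show "0 \<le> (\<Sum>p<N. \<Sum>q<N. Z p q * x p * x q)" for x
        using nonneg[of x 0] by simp
    qed
    then obtain y where y: "\<And>p q. p < N \<Longrightarrow> q < N \<Longrightarrow> Z p q = (\<Sum>l<N. y l p * y l q)"
      by blast
    define y' where "y' l p = (if l < N \<and> p < N then y l p else 0)" for l p
    have "Z p q = (\<Sum>l<Suc N. y' l p * y' l q)" if "p < Suc N" "q < Suc N" for p q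
    proof (cases "p < N \<and> q < N")
      case True
      then show ?thesis using y by (simp add: y'_def)
    next
      case False
      moreover have "Z N q = Z q N" using that by (intro Suc.prems(1)) auto
      ultimately show ?thesis using that h0 \<open>c = 0\<close>
        by (auto simp: y'_def h_def c_def less_Suc_eq)
    qed
    then show ?thesis by blast
  next
    case False
    then have c: "c > 0" using c0 by simp
    define Z' where "Z' p q = Z p q - h p * h q / c" for p q
    have "\<exists>y. \<forall>p<N. \<forall>q<N. Z' p q = (\<Sum>l<N. y l p * y l q)"
    proof (intro Suc.IH)
      show "Z' p q = Z' q p" if "p < N" "q < N" for p q
        using that Suc.prems(1)[of p q] by (simp add: Z'_def)
      fix x :: "nat \<Rightarrow> real"
      define S where "S = (\<Sum>p<N. h p * x p)"
      have S2: "S\<^sup>2 = (\<Sum>p<N. \<Sum>q<N. h p * h q * x p * x q)"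
        unfolding S_def power2_eq_square sum_product by (simp add: mult_ac)
      have "(\<Sum>p<N. \<Sum>q<N. Z' p q * x p * x q) = (\<Sum>p<N. \<Sum>q<N. Z p q * x p * x q) - S\<^sup>2 / c"
        unfolding S2 Z'_def sum_divide_distrib
        by (simp add: left_diff_distrib sum_subtractf)
      \<comment> \<open>The last coordinate \<open>- S / c\<close> minimizes the form for given \<open>x\<close>.\<close>
      moreover have "0 \<le> (\<Sum>p<N. \<Sum>q<N. Z p q * x p * x q) - S\<^sup>2 / c"
      proof -
        have "2 * (- S / c) * S + c * (- S / c)\<^sup>2 = - (S\<^sup>2 / c)"
          using c by (simp add: power2_eq_square)
        then show ?thesis using nonneg[of x "- S / c"] unfolding S_def[symmetric] by linarith
      qed
      ultimately show "0 \<le> (\<Sum>p<N. \<Sum>q<N. Z' p q * x p * x q)" by simp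
    qed
    then obtain y where y: "\<And>p q. p < N \<Longrightarrow> q < N \<Longrightarrow> Z' p q = (\<Sum>l<N. y l p * y l q)"
      by blast
    define y' where "y' l p = (if l = N then h p / sqrt c else if p < N then y l p else 0)" for l p
    have last: "y' N p * y' N q = h p * h q / c" for p q
      using c by (simp add: y'_def)
    have "Z p q = (\<Sum>l<Suc N. y' l p * y' l q)" if pq: "p < Suc N" "q < Suc N" for p q
    proof (cases "p < N \<and> q < N")
      case True
      then have "(\<Sum>l<N. y' l p * y' l q) = Z' p q"
        unfolding y[OF conjunct1[OF True] conjunct2[OF True]]
        by (intro sum.cong) (auto simp: y'_def)
      then show ?thesis by (simp add: last Z'_def)
    next
      case False
      then have "(\<Sum>l<N. y' l p * y' l q) = 0"
        by (intro sum.neutral) (auto simp: y'_def)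
      moreover have "Z p q = h p * h q / c"
      proof -
        have "Z p q = Z q p" using pq by (intro Suc.prems(1))
        then show ?thesis using False pq c by (auto simp: h_def c_def less_Suc_eq)
      qed
      ultimately show ?thesis by (simp add: last)
    qed
    then show ?thesis by blast
  qed
qed

text \<open>
  A maximal independent set of columns has \<open>rank A\<close> elements and spans all columns; \<open>sel\<close> lists
  their positions and \<open>C\<close> the coordinates.
\<close>
lemma (in vec_space) rank_column_basis:
  assumes A: "A \<in> carrier_mat n nc"
  obtains sel C where "\<And>j. j < rank A \<Longrightarrow> sel j < nc"
    and "\<And>p q. p < n \<Longrightarrow> q < nc \<Longrightarrow> A $$ (p, q) = (\<Sum>j<rank A. A $$ (p, sel j) * C j q)"
proof -
  have cols: "set (cols A) \<subseteq> carrier_vec n" using A cols_dim by blast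
  obtain U where U: "maximal U (\<lambda>T. T \<subseteq> set (cols A) \<and> lin_indpt T)" "finite U"
    using maximal_exists_superset[of "set (cols A)" "\<lambda>T. T \<subseteq> set (cols A) \<and> lin_indpt T" "{}"]
    by (metis (no_types, lifting) List.finite_set empty_subsetI finite_lin_indpt2 empty_iff finite.emptyI)
  have UA: "U \<subseteq> set (cols A)" "lin_indpt U" using U(1) unfolding maximal_def by auto
  have rank: "rank A = card U" using rank_card_indpt[OF A U(1)] .
  have Uc: "U \<subseteq> carrier_vec n" using UA cols by blast
  have span: "x \<in> span U" if x: "x \<in> set (cols A)" for x
  proof (rule ccontr)
    assume nin: "x \<notin> span U"
    have xc: "x \<in> carrier_vec n" using x cols by blast
    have xU: "x \<notin> U" using nin Uc span_mem by blast
    then have "lin_indpt (insert x U)"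
      using lin_dep_iff_in_span[OF Uc UA(2) xc xU] nin by auto
    then have "insert x U = U" using U(1) UA x unfolding maximal_def by blast
    then show False using xU by blast
  qed
  obtain us where us: "bij_betw us {..<card U} U"
    using ex_bij_betw_nat_finite[OF U(2)] by (auto simp: atLeast0LessThan)
  have "\<forall>j<card U. \<exists>s<nc. us j = col A s"
  proof (intro allI impI)
    fix j assume "j < card U"
    then have "us j \<in> set (cols A)" using us UA bij_betwE by fastforce
    then show "\<exists>s<nc. us j = col A s" using A
      by (metis carrier_matD(2) cols_length cols_nth in_set_conv_nth)
  qed
  then obtain sel where sel: "\<And>j. j < card U \<Longrightarrow> sel j < nc \<and> us j = col A (sel j)" by metis
  have "\<forall>q. \<exists>a. q < nc \<longrightarrow> col A q = lincomb a U"
  proof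
    fix q
    show "\<exists>a. q < nc \<longrightarrow> col A q = lincomb a U"
    proof (cases "q < nc")
      case True
      then have "col A q \<in> span U" using span A
        by (metis carrier_matD(2) cols_length cols_nth nth_mem)
      then obtain a where "lincomb a U = col A q"
        using finite_in_span[OF U(2), of "col A q"] Uc by auto
      then have "col A q = lincomb a U" by simp
      then show ?thesis by blast
    qed simp
  qed
  then obtain a where a: "\<And>q. q < nc \<Longrightarrow> col A q = lincomb (a q) U" by metis
  show thesis
  proof
    show "sel j < nc" if "j < rank A" for j using sel that rank by simp
    fix p q assume p: "p < n" and q: "q < nc"
    have "A $$ (p, q) = lincomb (a q) U $ p"
      using a[OF q] p q A index_col[of p A q] by simp
    also have "\<dots> = (\<Sum>x\<in>U. a q x * x $ p)" by (rule lincomb_index[OF p Uc])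
    also have "\<dots> = (\<Sum>j<card U. a q (us j) * us j $ p)"
      by (rule sum.reindex_bij_betw[OF us, symmetric])
    also have "\<dots> = (\<Sum>j<card U. A $$ (p, sel j) * a q (us j))"
      using sel p A by (intro sum.cong) auto
    finally show "A $$ (p, q) = (\<Sum>j<rank A. A $$ (p, sel j) * a q (us j))" by (simp add: rank)
  qed
qed

lemma quadratic_form_vec:
  fixes X :: "real mat"
  assumes "X \<in> carrier_mat N N"
  shows "vec N x \<bullet> (X *\<^sub>v vec N x) = (\<Sum>p<N. \<Sum>q<N. X $$ (p, q) * x p * x q)"
proof -
  have "vec N x \<bullet> (X *\<^sub>v vec N x) = (\<Sum>p<N. x p * (\<Sum>q<N. X $$ (p, q) * x q))"
    using assms by (simp add: scalar_prod_def atLeast0LessThan)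
  also have "\<dots> = (\<Sum>p<N. \<Sum>q<N. X $$ (p, q) * x p * x q)"
    unfolding sum_distrib_left by (simp add: ac_simps)
  finally show ?thesis .
qed

text \<open>
  Let \<open>S\<close> be the submatrix of \<open>X\<close> in the rows and columns of a column basis. Expressing all columns
  by the basis, and then, by symmetry, all rows, gives \<open>X = C\<^sup>T S C\<close>. As \<open>S\<close> has
  size \<open>rank X\<close>, a Cholesky factorization of \<open>S\<close> yields exactly \<open>rank X\<close> vectors.
\<close>
lemma psd_rank_gram:
  assumes X: "psd N X"
  obtains w where "\<And>j. w j \<in> carrier_vec N" and "X = gram N {1..vec_space.rank N X} w"
proof -
  have Xc: "X \<in> carrier_mat N N" using X by (simp add: psd_def)
  have sym: "X $$ (p, q) = X $$ (q, p)" if "p < N" "q < N" for p q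
    using X that unfolding psd_def by (metis carrier_matD index_transpose_mat(1))
  define r where "r = vec_space.rank N X"
  obtain sel C where sel: "\<And>j. j < r \<Longrightarrow> sel j < N"
    and C: "\<And>p q. p < N \<Longrightarrow> q < N \<Longrightarrow> X $$ (p, q) = (\<Sum>j<r. X $$ (p, sel j) * C j q)"
    using vec_space.rank_column_basis[OF Xc] unfolding r_def by blast
  have "\<exists>y. \<forall>j<r. \<forall>k<r. X $$ (sel j, sel k) = (\<Sum>l<r. y l j * y l k)"
  proof (rule nonneg_form_gram)
    show "X $$ (sel p, sel q) = X $$ (sel q, sel p)" if "p < r" "q < r" for p q
      using that sel sym by blast
    fix x :: "nat \<Rightarrow> real"
    \<comment> \<open>The vector \<open>\<Sum>\<^sub>j x\<^sub>j e\<^bsub>sel j\<^esub>\<close>.\<close>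
    define v where "v p = (\<Sum>j<r. if sel j = p then x j else 0)" for p
    have pick: "(\<Sum>p<N. f p * v p) = (\<Sum>j<r. f (sel j) * x j)" for f
    proof -
      have "(\<Sum>p<N. f p * v p) = (\<Sum>p<N. \<Sum>j<r. if sel j = p then f (sel j) * x j else 0)"
        unfolding v_def sum_distrib_left by (intro sum.cong) auto
      also have "\<dots> = (\<Sum>j<r. \<Sum>p<N. if sel j = p then f (sel j) * x j else 0)"
        by (rule sum.swap)
      also have "\<dots> = (\<Sum>j<r. f (sel j) * x j)" using sel by (intro sum.cong) auto
      finally show ?thesis .
    qed
    have "0 \<le> vec N v \<bullet> (X *\<^sub>v vec N v)" using X by (simp add: psd_def)
    also have "\<dots> = (\<Sum>p<N. (\<Sum>q<N. X $$ (p, q) * v q) * v p)"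
      unfolding quadratic_form_vec[OF Xc] sum_distrib_right by (simp add: mult_ac)
    also have "\<dots> = (\<Sum>j<r. \<Sum>k<r. X $$ (sel j, sel k) * x j * x k)"
    proof -
      have "(\<Sum>p<N. (\<Sum>q<N. X $$ (p, q) * v q) * v p)
          = (\<Sum>j<r. (\<Sum>k<r. X $$ (sel j, sel k) * x k) * x j)"
        unfolding pick[of "\<lambda>q. X $$ (_, q)"] by (rule pick)
      then show ?thesis by (simp add: sum_distrib_left ac_simps)
    qed
    finally show "0 \<le> (\<Sum>j<r. \<Sum>k<r. X $$ (sel j, sel k) * x j * x k)" .
  qed
  then obtain y where y: "\<And>j k. j < r \<Longrightarrow> k < r \<Longrightarrow> X $$ (sel j, sel k) = (\<Sum>l<r. y l j * y l k)"
    by blast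
  \<comment> \<open>The index is shifted because \<open>y\<close> starts at 0.\<close>
  define w where "w l = vec N (\<lambda>p. \<Sum>j<r. y (l - 1) j * C j p)" for l
  have "X $$ (p, q) = gram N {1..r} w $$ (p, q)" if p: "p < N" and q: "q < N" for p q
  proof -
    have "X $$ (p, q) = (\<Sum>j<r. X $$ (sel j, p) * C j q)"
      unfolding C[OF p q] using sym[OF p sel] by (intro sum.cong) auto
    also have "\<dots> = (\<Sum>j<r. \<Sum>k<r. X $$ (sel j, sel k) * C k p * C j q)"
      using C[OF sel p] by (intro sum.cong refl) (metis lessThan_iff sum_distrib_right)
    also have "\<dots> = (\<Sum>j<r. \<Sum>k<r. \<Sum>l<r. (y l k * C k p) * (y l j * C j q))"
      by (simp add: y sum_distrib_left mult_ac)
    also have "\<dots> = (\<Sum>j<r. \<Sum>l<r. \<Sum>k<r. (y l k * C k p) * (y l j * C j q))"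
      by (intro sum.cong refl sum.swap)
    also have "\<dots> = (\<Sum>l<r. \<Sum>j<r. \<Sum>k<r. (y l k * C k p) * (y l j * C j q))"
      by (rule sum.swap)
    also have "\<dots> = (\<Sum>l<r. w (Suc l) $ p * w (Suc l) $ q)"
    proof (rule sum.cong[OF refl])
      fix l
      have "(\<Sum>j<r. \<Sum>k<r. (y l k * C k p) * (y l j * C j q))
          = (\<Sum>k<r. \<Sum>j<r. (y l k * C k p) * (y l j * C j q))"
        by (rule sum.swap)
      then show "(\<Sum>j<r. \<Sum>k<r. (y l k * C k p) * (y l j * C j q)) = w (Suc l) $ p * w (Suc l) $ q"
        using p q by (simp add: w_def sum_product)
    qed
    also have "\<dots> = (\<Sum>l\<in>{1..r}. w l $ p * w l $ q)"
      by (simp add: sum.lessThan_Suc_shift sum.atLeast1_atMost_eq)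
    finally show ?thesis using p q by (simp add: gram_def)
  qed
  then have "X = gram N {1..r} w" using Xc by (intro eq_matI) (auto simp: gram_def)
  then show thesis using that[of w] unfolding r_def w_def by auto
qed

lemma rank_gram_le:
  assumes "finite J"
  shows "vec_space.rank N (gram N J w) \<le> card J"
  using assms
proof (induction J)
  case empty
  have "gram N {} w = 0\<^sub>m N N" by (intro eq_matI) (auto simp: gram_def)
  then show ?case by (simp add: vec_space.rank_0I)
next
  case (insert j J)
  have "gram N (insert j J) w = gram N {j} w + gram N J w"
    using insert.hyps by (intro eq_matI) (auto simp: gram_def)
  moreover have "vec_space.rank N (gram N {j} w) \<le> 1"
    by (rule vec_space.rank_le_1_product_entries[where f = "\<lambda>p. w j $ p" and g = "\<lambda>q. w j $ q"])
      (auto simp: gram_def)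
  ultimately show ?case
    using vec_space.rank_subadditive[of "gram N {j} w" N N "gram N J w"] insert by fastforce
qed

lemma sum_rotate3:
  fixes f :: "'a \<Rightarrow> 'b \<Rightarrow> 'c \<Rightarrow> 'd :: comm_monoid_add"
  shows "(\<Sum>p\<in>A. \<Sum>q\<in>B. \<Sum>j\<in>J. f p q j) = (\<Sum>j\<in>J. \<Sum>p\<in>A. \<Sum>q\<in>B. f p q j)"
proof -
  have "(\<Sum>p\<in>A. \<Sum>q\<in>B. \<Sum>j\<in>J. f p q j) = (\<Sum>p\<in>A. \<Sum>j\<in>J. \<Sum>q\<in>B. f p q j)"
    by (intro sum.cong refl sum.swap)
  also have "\<dots> = (\<Sum>j\<in>J. \<Sum>p\<in>A. \<Sum>q\<in>B. f p q j)" by (rule sum.swap)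
  finally show ?thesis .
qed

lemma mult_mat_vec_entry:
  "A \<in> carrier_mat nr nc \<Longrightarrow> v \<in> carrier_vec nc \<Longrightarrow> p < nr \<Longrightarrow>
    (A *\<^sub>v v) $ p = (\<Sum>q<nc. A $$ (p, q) * v $ q)"
  by (simp add: scalar_prod_def atLeast0LessThan)

lemma quadratic_form_entries:
  fixes C :: "real mat"
  assumes "C \<in> carrier_mat N N" "v \<in> carrier_vec N"
  shows "v \<bullet> (C *\<^sub>v v) = (\<Sum>p<N. \<Sum>q<N. C $$ (p, q) * v $ p * v $ q)"
proof -
  have "vec N (($) v) = v" using assms by (intro eq_vecI) auto
  then show ?thesis using quadratic_form_vec[OF assms(1), of "($) v"] by simp
qed

text \<open>
  This identity turns linear functionals of \<open>X\<close> into sums of quadratic forms of the vectors of a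
  decomposition; all constraints and the objective are evaluated through it.
\<close>
lemma mat_inner_gram:
  assumes C: "C \<in> carrier_mat N N" and w: "\<And>j. j \<in> J \<Longrightarrow> w j \<in> carrier_vec N"
  shows "mat_inner C (gram N J w) = (\<Sum>j\<in>J. w j \<bullet> (C *\<^sub>v w j))"
proof -
  have "mat_inner C (gram N J w) = (\<Sum>p<N. \<Sum>q<N. \<Sum>j\<in>J. C $$ (p, q) * w j $ p * w j $ q)"
    using C by (simp add: mat_inner_def gram_def sum_distrib_left mult.assoc)
  then show ?thesis
    by (simp add: sum_rotate3[where J = J] quadratic_form_entries[OF C w])
qed

lemma psd_gram:
  assumes w: "\<And>j. j \<in> J \<Longrightarrow> w j \<in> carrier_vec N"
  shows "psd N (gram N J w)"
  unfolding psd_def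
proof (intro conjI ballI)
  show "transpose_mat (gram N J w) = gram N J w"
    by (intro eq_matI) (auto simp: gram_def mult.commute)
  fix v :: "real vec" assume v: "v \<in> carrier_vec N"
  have "v \<bullet> (gram N J w *\<^sub>v v) = (\<Sum>p<N. \<Sum>q<N. \<Sum>j\<in>J. (w j $ p * v $ p) * (w j $ q * v $ q))"
    unfolding quadratic_form_entries[OF gram_carrier v] by (simp add: gram_def sum_distrib_left mult_ac)
  also have "\<dots> = (\<Sum>j\<in>J. (\<Sum>p<N. w j $ p * v $ p)\<^sup>2)"
    unfolding sum_rotate3[where J = J] power2_eq_square sum_product ..
  finally show "0 \<le> v \<bullet> (gram N J w *\<^sub>v v)" by (simp add: sum_nonneg)
qed simp

lemma congruence_entry:
  assumes W: "W \<in> carrier_mat N r" and M: "M \<in> carrier_mat r r" and "p < N" "q < N"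
  shows "(W * M * transpose_mat W) $$ (p, q)
    = (\<Sum>i<r. \<Sum>j<r. W $$ (p, i) * M $$ (i, j) * W $$ (q, j))"
proof -
  have "(W * M * transpose_mat W) $$ (p, q)
      = (\<Sum>j<r. (\<Sum>i<r. W $$ (p, i) * M $$ (i, j)) * W $$ (q, j))"
    using assms by (simp add: scalar_prod_def atLeast0LessThan del: assoc_mult_mat)
  also have "\<dots> = (\<Sum>i<r. \<Sum>j<r. W $$ (p, i) * M $$ (i, j) * W $$ (q, j))"
    unfolding sum_distrib_right by (rule sum.swap)
  finally show ?thesis .
qed

lemma congruence_gram:
  assumes W: "W \<in> carrier_mat N r" and y: "\<And>j. j \<in> J \<Longrightarrow> y j \<in> carrier_vec r"
  shows "W * gram r J y * transpose_mat W = gram N J (\<lambda>j. W *\<^sub>v y j)"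
proof (intro eq_matI)
  fix p q assume "p < dim_row (gram N J (\<lambda>j. W *\<^sub>v y j))" "q < dim_col (gram N J (\<lambda>j. W *\<^sub>v y j))"
  then have pq: "p < N" "q < N" by (simp_all add: gram_def)
  have "(W * gram r J y * transpose_mat W) $$ (p, q)
      = (\<Sum>i<r. \<Sum>k<r. \<Sum>j\<in>J. (W $$ (p, i) * y j $ i) * (W $$ (q, k) * y j $ k))"
    unfolding congruence_entry[OF W gram_carrier pq]
    using pq by (simp add: gram_def sum_distrib_left mult_ac)
  also have "\<dots> = (\<Sum>j\<in>J. (W *\<^sub>v y j) $ p * (W *\<^sub>v y j) $ q)"
    unfolding sum_rotate3[where J = J] by (simp add: mult_mat_vec_entry[OF W y] pq sum_product)
  finally show "(W * gram r J y * transpose_mat W) $$ (p, q) = gram N J (\<lambda>j. W *\<^sub>v y j) $$ (p, q)"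
    using pq by (simp add: gram_def)
qed (use W in \<open>auto simp: gram_def\<close>)

lemma psd_congruence:
  assumes W: "W \<in> carrier_mat N r" and M: "psd r M"
  shows "psd N (W * M * transpose_mat W)"
    and "vec_space.rank N (W * M * transpose_mat W) \<le> vec_space.rank r M"
proof -
  obtain y where y: "\<And>j. y j \<in> carrier_vec r" "M = gram r {1..vec_space.rank r M} y"
    using psd_rank_gram[OF M] by blast
  have eq: "W * M * transpose_mat W = gram N {1..vec_space.rank r M} (\<lambda>j. W *\<^sub>v y j)"
    using congruence_gram[OF W, of "{1..vec_space.rank r M}" y] y by metis
  show "psd N (W * M * transpose_mat W)"
    unfolding eq using W y(1) by (intro psd_gram) auto
  show "vec_space.rank N (W * M * transpose_mat W) \<le> vec_space.rank r M"
    unfolding eq using rank_gram_le[of "{1..vec_space.rank r M}" N "\<lambda>j. W *\<^sub>v y j"] by simp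
qed

lemma gram_as_product:
  "gram N {1..r} w = mat N r (\<lambda>(p, j). w (Suc j) $ p) * transpose_mat (mat N r (\<lambda>(p, j). w (Suc j) $ p))"
  by (intro eq_matI)
    (auto simp: gram_def scalar_prod_def atLeast0LessThan sum.atLeast1_atMost_eq)

section \<open>The boundary of the cone along a line through the identity\<close>

lemma quadratic_form_bound:
  fixes E :: "real mat"
  assumes E: "E \<in> carrier_mat r r" and v: "v \<in> carrier_vec r"
  shows "\<bar>v \<bullet> (E *\<^sub>v v)\<bar> \<le> (\<Sum>i<r. \<Sum>j<r. \<bar>E $$ (i, j)\<bar>) * (v \<bullet> v)"
proof -
  have vv: "v \<bullet> v = (\<Sum>i<r. (v $ i)\<^sup>2)"
    using v by (simp add: scalar_prod_def atLeast0LessThan power2_eq_square)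
  have prod: "\<bar>v $ i * v $ j\<bar> \<le> v \<bullet> v" if "i < r" "j < r" for i j
  proof -
    have "(v $ i)\<^sup>2 \<le> v \<bullet> v" "(v $ j)\<^sup>2 \<le> v \<bullet> v"
      unfolding vv using that by (auto intro!: member_le_sum)
    moreover have "2 * \<bar>v $ i * v $ j\<bar> \<le> (v $ i)\<^sup>2 + (v $ j)\<^sup>2"
      using sum_squares_bound[of "\<bar>v $ i\<bar>" "\<bar>v $ j\<bar>"] by (simp add: abs_mult)
    ultimately show ?thesis by linarith
  qed
  have "\<bar>v \<bullet> (E *\<^sub>v v)\<bar> \<le> (\<Sum>i<r. \<Sum>j<r. \<bar>E $$ (i, j) * v $ i * v $ j\<bar>)"
    unfolding quadratic_form_entries[OF E v]
    by (intro order_trans[OF sum_abs] sum_mono order_refl)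
  also have "\<dots> \<le> (\<Sum>i<r. \<Sum>j<r. \<bar>E $$ (i, j)\<bar> * (v \<bullet> v))"
  proof (intro sum_mono)
    fix i j assume "i \<in> {..<r}" "j \<in> {..<r}"
    then show "\<bar>E $$ (i, j) * v $ i * v $ j\<bar> \<le> \<bar>E $$ (i, j)\<bar> * (v \<bullet> v)"
      using mult_left_mono[OF prod[of i j], of "\<bar>E $$ (i, j)\<bar>"] by (simp add: abs_mult mult.assoc)
  qed
  also have "\<dots> = (\<Sum>i<r. \<Sum>j<r. \<bar>E $$ (i, j)\<bar>) * (v \<bullet> v)"
    by (simp add: sum_distrib_right)
  finally show ?thesis .
qed

lemma pencil_form:
  fixes D :: "real mat"
  assumes D: "D \<in> carrier_mat r r" and v: "v \<in> carrier_vec r"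
  shows "v \<bullet> ((1\<^sub>m r + t \<cdot>\<^sub>m D) *\<^sub>v v) = v \<bullet> v + t * (v \<bullet> (D *\<^sub>v v))"
proof -
  have "(t \<cdot>\<^sub>m D) *\<^sub>v v = t \<cdot>\<^sub>v (D *\<^sub>v v)"
    using D v by (intro eq_vecI) (auto simp: scalar_prod_def sum_distrib_left mult_ac)
  then have "(1\<^sub>m r + t \<cdot>\<^sub>m D) *\<^sub>v v = v + t \<cdot>\<^sub>v (D *\<^sub>v v)"
    using D v by (simp add: add_mult_distrib_mat_vec[of _ r r])
  then show ?thesis using D v by (simp add: scalar_prod_add_distrib[of _ r])
qed

lemma psd_pencil_iff:
  assumes D: "D \<in> carrier_mat r r" and sym: "transpose_mat D = D"
  shows "psd r (1\<^sub>m r + t \<cdot>\<^sub>m D) \<longleftrightarrow> (\<forall>v\<in>carrier_vec r. 0 \<le> v \<bullet> v + t * (v \<bullet> (D *\<^sub>v v)))"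
proof -
  have "transpose_mat (1\<^sub>m r + t \<cdot>\<^sub>m D) = 1\<^sub>m r + t \<cdot>\<^sub>m D"
  proof (intro eq_matI)
    fix i j assume "i < dim_row (1\<^sub>m r + t \<cdot>\<^sub>m D)" "j < dim_col (1\<^sub>m r + t \<cdot>\<^sub>m D)"
    then have ij: "i < r" "j < r" using D by auto
    have "D $$ (j, i) = D $$ (i, j)" using sym ij D by (metis carrier_matD index_transpose_mat(1))
    then show "transpose_mat (1\<^sub>m r + t \<cdot>\<^sub>m D) $$ (i, j) = (1\<^sub>m r + t \<cdot>\<^sub>m D) $$ (i, j)"
      using ij D by auto
  qed (use D in auto)
  moreover have "1\<^sub>m r + t \<cdot>\<^sub>m D \<in> carrier_mat r r" using D by simp
  ultimately show ?thesis unfolding psd_def using pencil_form[OF D] by auto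
qed

lemma psd_pencil_near_zero:
  assumes D: "D \<in> carrier_mat r r" and sym: "transpose_mat D = D"
  shows "\<exists>\<epsilon>>0. \<forall>s. \<bar>s\<bar> \<le> \<epsilon> \<longrightarrow> psd r (1\<^sub>m r + s \<cdot>\<^sub>m D)"
proof -
  define K where "K = (\<Sum>i<r. \<Sum>j<r. \<bar>D $$ (i, j)\<bar>)"
  have K: "0 \<le> K" by (simp add: K_def sum_nonneg)
  have "psd r (1\<^sub>m r + s \<cdot>\<^sub>m D)" if s: "\<bar>s\<bar> \<le> 1 / (K + 1)" for s
    unfolding psd_pencil_iff[OF D sym]
  proof
    fix v :: "real vec" assume v: "v \<in> carrier_vec r"
    have vv: "0 \<le> v \<bullet> v" by (simp add: scalar_prod_def sum_nonneg)
    have "\<bar>s * (v \<bullet> (D *\<^sub>v v))\<bar> \<le> (1 / (K + 1)) * (K * (v \<bullet> v))"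
      unfolding abs_mult using s quadratic_form_bound[OF D v] K unfolding K_def
      by (intro mult_mono) auto
    also have "\<dots> = (K / (K + 1)) * (v \<bullet> v)" by simp
    also have "\<dots> \<le> 1 * (v \<bullet> v)" using K vv by (intro mult_right_mono) auto
    finally show "0 \<le> v \<bullet> v + s * (v \<bullet> (D *\<^sub>v v))" by linarith
  qed
  then show ?thesis using K by (intro exI[of _ "1 / (K + 1)"]) auto
qed

text \<open>
  Because of the negative direction \<open>x\<close>, the parameters \<open>t\<close> that keep \<open>1 + t D\<close> in the cone are bounded
  above, and they form a closed set, so there is a largest one. If \<open>M = 1 + t D\<close> were nonsingular there,
  then \<open>M = Y Y\<^sup>T\<close> with \<open>Y\<close> invertible; in the coordinates \<open>s = Y\<^sup>T v\<close> the form of \<open>M\<close>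
  is \<open>s \<bullet> s\<close>, which dominates any other quadratic form up to a constant, so \<open>t\<close> could
  be increased.
\<close>
lemma psd_pencil_singular_neg:
  assumes D: "D \<in> carrier_mat r r" and sym: "transpose_mat D = D"
    and x: "x \<in> carrier_vec r" "x \<bullet> (D *\<^sub>v x) < 0"
  shows "\<exists>t. psd r (1\<^sub>m r + t \<cdot>\<^sub>m D) \<and> det (1\<^sub>m r + t \<cdot>\<^sub>m D) = 0"
proof -
  define T where "T = {t. psd r (1\<^sub>m r + t \<cdot>\<^sub>m D)}"
  have T_eq: "T = (\<Inter>v\<in>carrier_vec r. {t. 0 \<le> v \<bullet> v + t * (v \<bullet> (D *\<^sub>v v))})"
    unfolding T_def psd_pencil_iff[OF D sym] by auto
  have "closed T" unfolding T_eq
    by (intro closed_INT ballI closed_Collect_le continuous_intros)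
  moreover have "0 \<in> T" unfolding T_eq by (auto simp: scalar_prod_def sum_nonneg)
  moreover define B where "B = (x \<bullet> x) / (- (x \<bullet> (D *\<^sub>v x)))"
  have bdd: "t \<le> B" if "t \<in> T" for t
  proof -
    from that have "0 \<le> x \<bullet> x + t * (x \<bullet> (D *\<^sub>v x))" using x unfolding T_eq by auto
    then show "t \<le> B" using x(2) by (simp add: B_def field_simps)
  qed
  ultimately have "compact ({0..B} \<inter> T)" "0 \<in> {0..B} \<inter> T"
    using bdd[of 0] by auto
  then obtain tm where tm: "tm \<in> {0..B} \<inter> T" "\<forall>t\<in>{0..B} \<inter> T. t \<le> tm"
    using compact_attains_sup[of "{0..B} \<inter> T"] by blast
  have sup: "tm \<in> T" using tm by simp
  have max: "t \<le> tm" if "t \<in> T" for t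
    using tm bdd[OF that] that by (cases "0 \<le> t") auto
  define M where "M = 1\<^sub>m r + tm \<cdot>\<^sub>m D"
  have M: "psd r M" using sup by (simp add: T_def M_def)
  have Mc: "M \<in> carrier_mat r r" using M by (simp add: psd_def)
  have "det M = 0"
  proof (rule ccontr)
    assume det: "det M \<noteq> 0"
    then have "vec_space.rank r M = r" using vec_space.low_rank_det_zero[OF Mc] by blast
    then obtain y where y: "\<And>j. y j \<in> carrier_vec r" "M = gram r {1..r} y"
      using psd_rank_gram[OF M] by metis
    define Y where "Y = mat r r (\<lambda>(p, j). y (Suc j) $ p)"
    have Yc: "Y \<in> carrier_mat r r" "transpose_mat Y \<in> carrier_mat r r" by (simp_all add: Y_def)
    have MY: "M = Y * transpose_mat Y" unfolding y(2) Y_def by (rule gram_as_product)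
    then have "det (transpose_mat Y) \<noteq> 0" using det det_mult[OF Yc] by auto
    then obtain Q where Q: "Q * transpose_mat Y = 1\<^sub>m r" "Q \<in> carrier_mat r r"
      using det_non_zero_imp_unit[OF Yc(2), of "()"] unfolding Units_def ring_mat_def by auto
    define E where "E = transpose_mat Q * D * Q"
    have Ec: "E \<in> carrier_mat r r" using Q D by (simp add: E_def)
    define K where "K = (\<Sum>i<r. \<Sum>j<r. \<bar>E $$ (i, j)\<bar>)"
    have K: "0 \<le> K" by (simp add: K_def sum_nonneg)
    define e where "e = 1 / (K + 1)"
    have e: "0 < e" "e * K \<le> 1" using K by (simp_all add: e_def)
    have "tm + e \<in> T" unfolding T_eq
    proof safe
      fix v :: "real vec" assume v: "v \<in> carrier_vec r"
      define s where "s = transpose_mat Y *\<^sub>v v"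
      have s: "s \<in> carrier_vec r" using Yc v by (simp add: s_def)
      have vQ: "v = Q *\<^sub>v s"
        unfolding s_def using Q Yc v by (metis assoc_mult_mat_vec one_mult_mat_vec)
      have "v \<bullet> (D *\<^sub>v v) = s \<bullet> (E *\<^sub>v s)"
      proof -
        have "E *\<^sub>v s = transpose_mat Q *\<^sub>v (D *\<^sub>v v)"
          unfolding E_def vQ using Q D s by (simp add: assoc_mult_mat_vec[of _ r r _ r])
        then show ?thesis
          using transpose_vec_mult_scalar[OF Q(2) s, of "D *\<^sub>v v"] D v s Q vQ
            comm_scalar_prod[of "D *\<^sub>v v" r v] comm_scalar_prod[of s r "E *\<^sub>v s"] Ec
          by simp
      qed
      moreover have "v \<bullet> v + tm * (v \<bullet> (D *\<^sub>v v)) = s \<bullet> s"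
      proof -
        have "v \<bullet> (M *\<^sub>v v) = s \<bullet> s"
          unfolding MY using transpose_vec_mult_scalar[OF Yc(1) s v] Yc v s
          by (simp add: assoc_mult_mat_vec[of _ r r _ r] s_def)
        moreover have "v \<bullet> (M *\<^sub>v v) = v \<bullet> v + tm * (v \<bullet> (D *\<^sub>v v))"
          unfolding M_def by (rule pencil_form[OF D v])
        ultimately show ?thesis by simp
      qed
      moreover have "e * \<bar>s \<bullet> (E *\<^sub>v s)\<bar> \<le> s \<bullet> s"
      proof -
        have "e * \<bar>s \<bullet> (E *\<^sub>v s)\<bar> \<le> e * (K * (s \<bullet> s))"
          using quadratic_form_bound[OF Ec s] e unfolding K_def by (intro mult_left_mono) auto
        also have "\<dots> \<le> 1 * (s \<bullet> s)" unfolding mult.assoc[symmetric]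
          using e by (intro mult_right_mono) (auto simp: scalar_prod_def sum_nonneg)
        finally show ?thesis by simp
      qed
      moreover have "- (e * \<bar>s \<bullet> (E *\<^sub>v s)\<bar>) \<le> e * (s \<bullet> (E *\<^sub>v s))"
        using e by (simp add: abs_if)
      ultimately show "0 \<le> v \<bullet> v + (tm + e) * (v \<bullet> (D *\<^sub>v v))"
        by (simp add: distrib_right)
    qed
    then show False using max[of "tm + e"] e by simp
  qed
  then show ?thesis using M unfolding M_def by blast
qed

text \<open>
  By polarization: evaluating the form at \<open>e\<^sub>i + e\<^sub>j\<close>, also for \<open>i = j\<close>, recovers all entries.
\<close>
lemma quadratic_form_nonzero:
  fixes D :: "real mat"
  assumes D: "D \<in> carrier_mat r r" and sym: "transpose_mat D = D" and "D \<noteq> 0\<^sub>m r r"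
  shows "\<exists>x\<in>carrier_vec r. x \<bullet> (D *\<^sub>v x) \<noteq> 0"
proof (rule ccontr)
  assume "\<not> ?thesis"
  then have zero: "x \<bullet> (D *\<^sub>v x) = 0" if "x \<in> carrier_vec r" for x using that by blast
  have "D $$ (i, j) + D $$ (j, i) + D $$ (i, i) + D $$ (j, j) = 0" if ij: "i < r" "j < r" for i j
  proof -
    define e where "e k = (if k = i then 1 else 0) + (if k = j then 1 else 0 :: real)" for k
    have pick: "(\<Sum>k<r. f k * e k) = f i + f j" for f
    proof -
      have "(\<Sum>k<r. f k * e k) = (\<Sum>k<r. if k = i then f k else 0) + (\<Sum>k<r. if k = j then f k else 0)"
        unfolding sum.distrib[symmetric] by (intro sum.cong) (auto simp: e_def)
      then show ?thesis using ij by simp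
    qed
    have "0 = (\<Sum>p<r. (\<Sum>q<r. D $$ (p, q) * e q) * e p)"
      using zero[of "vec r e"] unfolding quadratic_form_vec[OF D]
      by (simp add: sum_distrib_right sum_distrib_left mult_ac)
    then show ?thesis unfolding pick[of "\<lambda>q. D $$ (_, q)"] unfolding pick by simp
  qed
  note * = this
  have "D $$ (i, j) = 0" if ij: "i < r" "j < r" for i j
  proof -
    have "D $$ (j, i) = D $$ (i, j)" using sym ij D by (metis carrier_matD index_transpose_mat(1))
    then show ?thesis using *[OF ij] *[of i i] *[of j j] ij by simp
  qed
  then have "D = 0\<^sub>m r r" using D by (intro eq_matI) auto
  then show False using assms by blast
qed

lemma psd_pencil_singular:
  fixes D :: "real mat"
  assumes D: "D \<in> carrier_mat r r" and sym: "transpose_mat D = D" and "D \<noteq> 0\<^sub>m r r"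
  shows "\<exists>t. psd r (1\<^sub>m r + t \<cdot>\<^sub>m D) \<and> det (1\<^sub>m r + t \<cdot>\<^sub>m D) = 0"
proof -
  obtain x where x: "x \<in> carrier_vec r" "x \<bullet> (D *\<^sub>v x) \<noteq> 0"
    using quadratic_form_nonzero[OF assms] by blast
  show ?thesis
  proof (cases "x \<bullet> (D *\<^sub>v x) < 0")
    case True
    then show ?thesis using psd_pencil_singular_neg[OF D sym x(1)] by blast
  next
    case False
    have "(- D) *\<^sub>v x = - (D *\<^sub>v x)" using D x by (intro eq_vecI) auto
    then have "x \<bullet> ((- D) *\<^sub>v x) < 0" using x False D by simp
    moreover have "transpose_mat (- D) = - D" using sym by (simp add: transpose_uminus)
    ultimately obtain t where t: "psd r (1\<^sub>m r + t \<cdot>\<^sub>m (- D))" "det (1\<^sub>m r + t \<cdot>\<^sub>m (- D)) = 0"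
      using psd_pencil_singular_neg[of "- D" r x] D x by auto
    have "t \<cdot>\<^sub>m (- D) = (- t) \<cdot>\<^sub>m D" using D by (intro eq_matI) auto
    then show ?thesis using t by metis
  qed
qed

section \<open>Lowering the rank under linear constraints\<close>

text \<open>
  Gaussian elimination by induction on the number of equations. The equations are given as the set
  of their coefficient functions, so that equations of different origin can be collected by a union.
\<close>
lemma underdetermined_kernel:
  fixes K :: "('a \<Rightarrow> real) set"
  assumes "finite I" "finite K" "card K < card I"
  shows "\<exists>y. (\<exists>i\<in>I. y i \<noteq> 0) \<and> (\<forall>a\<in>K. (\<Sum>i\<in>I. a i * y i) = 0)"
  using assms
proof (induction "card K" arbitrary: I K rule: less_induct)
  case less
  show ?case
  proof (cases "K = {}")
    case True
    then obtain i where "i \<in> I" using less.prems by fastforce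
    then show ?thesis using True by (intro exI[of _ "\<lambda>_. 1"]) auto
  next
    case False
  then obtain a K' where K: "K = insert a K'" "a \<notin> K'" by (meson Set.set_insert ex_in_conv)
  have K': "finite K'" "card K = Suc (card K')" using K less.prems by auto
  show ?thesis
  proof (cases "\<exists>i\<in>I. a i \<noteq> 0")
    case False
    then show ?thesis using less.hyps[of K' I] K K' less.prems by auto
  next
    case True
    then obtain i0 where i0: "i0 \<in> I" "a i0 \<noteq> 0" by blast
    \<comment> \<open>Coefficients after the variable \<open>i0\<close> has been eliminated by means of equation \<open>a\<close>.\<close>
    define red where "red a' = (\<lambda>i. a' i - a' i0 * a i / a i0)" for a'
    define I' where "I' = I - {i0}"
    have I': "finite I'" "card I' = card I - 1" "I = insert i0 I'" "i0 \<notin> I'"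
      using i0 less.prems by (auto simp: I'_def)
    have le: "card (red ` K') \<le> card K'" using K' card_image_le by blast
    have "\<exists>y. (\<exists>i\<in>I'. y i \<noteq> 0) \<and> (\<forall>a\<in>red ` K'. (\<Sum>i\<in>I'. a i * y i) = 0)"
      using le K' I' less.prems by (intro less.hyps) auto
    then obtain y where y: "\<exists>i\<in>I'. y i \<noteq> 0"
      "\<And>a'. a' \<in> K' \<Longrightarrow> (\<Sum>i\<in>I'. red a' i * y i) = 0" by blast
    define s where "s = (\<Sum>i\<in>I'. a i * y i)"
    define y' where "y' = y(i0 := - s / a i0)"
    have split: "(\<Sum>i\<in>I. a' i * y' i) = (\<Sum>i\<in>I'. a' i * y i) - a' i0 * s / a i0" for a'
    proof -
      have "(\<Sum>i\<in>I'. a' i * y' i) = (\<Sum>i\<in>I'. a' i * y i)"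
        using I'(4) by (intro sum.cong) (auto simp: y'_def)
      then show ?thesis using I' by (simp add: y'_def)
    qed
    have "(\<Sum>i\<in>I. a i * y' i) = 0" unfolding split using i0 by (simp add: s_def)
    moreover have "(\<Sum>i\<in>I. a' i * y' i) = 0" if "a' \<in> K'" for a'
    proof -
      have "(\<Sum>i\<in>I'. red a' i * y i) = (\<Sum>i\<in>I'. a' i * y i) - a' i0 * s / a i0"
        by (simp add: red_def s_def left_diff_distrib sum_subtractf sum_distrib_left sum_divide_distrib mult.assoc)
      then show ?thesis using y(2)[OF that] unfolding split by simp
    qed
    moreover have "\<exists>i\<in>I. y' i \<noteq> 0" using y(1) I' by (auto simp: y'_def)
    ultimately show ?thesis unfolding K by blast
  qed
  qed
qed

lemma mat_inner_congruence:
  assumes C: "C \<in> carrier_mat N N" and W: "W \<in> carrier_mat N r" and M: "M \<in> carrier_mat r r"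
  shows "mat_inner C (W * M * transpose_mat W)
    = (\<Sum>i<r. \<Sum>j<r. (\<Sum>p<N. \<Sum>q<N. C $$ (p, q) * W $$ (p, i) * W $$ (q, j)) * M $$ (i, j))"
proof -
  have "mat_inner C (W * M * transpose_mat W)
      = (\<Sum>p<N. \<Sum>q<N. \<Sum>i<r. \<Sum>j<r. C $$ (p, q) * W $$ (p, i) * W $$ (q, j) * M $$ (i, j))"
    using C by (simp add: mat_inner_def congruence_entry[OF W M] sum_distrib_left mult_ac
        del: assoc_mult_mat)
  also have "\<dots> = (\<Sum>i<r. \<Sum>p<N. \<Sum>q<N. \<Sum>j<r. C $$ (p, q) * W $$ (p, i) * W $$ (q, j) * M $$ (i, j))"
    by (rule sum_rotate3)
  also have "\<dots> = (\<Sum>i<r. \<Sum>j<r. \<Sum>p<N. \<Sum>q<N. C $$ (p, q) * W $$ (p, i) * W $$ (q, j) * M $$ (i, j))"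
    by (intro sum.cong refl sum_rotate3)
  finally show ?thesis by (simp add: sum_distrib_right)
qed

lemma mat_inner_add_smult:
  assumes "C \<in> carrier_mat N N" "X \<in> carrier_mat N N" "D \<in> carrier_mat N N"
  shows "mat_inner C (X + s \<cdot>\<^sub>m D) = mat_inner C X + s * mat_inner C D"
  using assms by (simp add: mat_inner_def sum.distrib sum_distrib_left distrib_left mult_ac)

text \<open>
  Write \<open>X = W W\<^sup>T\<close> with \<open>r = rank X\<close> columns. The symmetric matrices \<open>E\<close> of size \<open>r\<close> form a space of
  dimension \<open>r (r + 1) / 2\<close>, so if there are fewer than that many constraint matrices, some \<open>E \<noteq> 0\<close> makes
  \<open>D = W E W\<^sup>T\<close> orthogonal to all of them. Since \<open>X + s D = W (1 + s E) W\<^sup>T\<close>, small \<open>s\<close> of either sign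
  stay in the cone, and moving until \<open>1 + t E\<close> becomes singular lowers the rank.
\<close>
lemma psd_rank_reduction:
  assumes X: "psd N X"
    and fin: "finite \<C>" and \<C>: "\<And>C. C \<in> \<C> \<Longrightarrow> C \<in> carrier_mat N N"
    and count: "2 * card \<C> < vec_space.rank N X * (vec_space.rank N X + 1)"
  obtains D \<epsilon> t where "D \<in> carrier_mat N N" "\<And>C. C \<in> \<C> \<Longrightarrow> mat_inner C D = 0"
    and "0 < \<epsilon>" "\<And>s. \<bar>s\<bar> \<le> \<epsilon> \<Longrightarrow> psd N (X + s \<cdot>\<^sub>m D)"
    and "psd N (X + t \<cdot>\<^sub>m D)" "vec_space.rank N (X + t \<cdot>\<^sub>m D) < vec_space.rank N X"
proof -
  define r where "r = vec_space.rank N X"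
  obtain w where w: "X = gram N {1..r} w" using psd_rank_gram[OF X] unfolding r_def by metis
  define W where "W = mat N r (\<lambda>(p, j). w (Suc j) $ p)"
  have Wc: "W \<in> carrier_mat N r" by (simp add: W_def)
  have XW: "X = W * transpose_mat W" unfolding w W_def by (rule gram_as_product)
  define G where "G C = (\<lambda>(i, j). \<Sum>p<N. \<Sum>q<N. C $$ (p, q) * W $$ (p, i) * W $$ (q, j))" for C
  \<comment> \<open>The unknowns are all \<open>r * r\<close> entries; \<open>anti\<close> lists the equations that express symmetry.\<close>
  define anti :: "nat \<times> nat \<Rightarrow> nat \<times> nat \<Rightarrow> real"
    where "anti = (\<lambda>(p, q) i. (if i = (p, q) then 1 else 0) - (if i = (q, p) then 1 else 0))"
  define L where "L = (SIGMA p:{..<r}. {..<p})"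
  define I where "I = {..<r} \<times> {..<r}"
  have "2 * card L = r * (r - 1)"
  proof -
    have "card L = \<Sum>{..<r}" by (simp add: L_def)
    also have "2 * \<Sum>{..<r} = r * (r - 1)" by (induction r) (auto simp: algebra_simps)
    finally show ?thesis .
  qed
  moreover have "card (G ` \<C> \<union> anti ` L) \<le> card \<C> + card L"
    using fin card_image_le[of \<C> G] card_image_le[of L anti] card_Un_le[of "G ` \<C>" "anti ` L"]
    by (simp add: L_def)
  moreover have "r * (r - 1) + r * (r + 1) = 2 * (r * r)" by (cases r) auto
  moreover have "card I = r * r" by (simp add: I_def)
  ultimately have "card (G ` \<C> \<union> anti ` L) < card I" using count unfolding r_def[symmetric] by linarith
  then have "\<exists>y. (\<exists>i\<in>I. y i \<noteq> 0) \<and> (\<forall>a\<in>G ` \<C> \<union> anti ` L. (\<Sum>i\<in>I. a i * y i) = 0)"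
    using fin by (intro underdetermined_kernel) (auto simp: I_def L_def)
  then obtain y where y_nz: "\<exists>i\<in>I. y i \<noteq> 0"
    and y: "\<forall>a\<in>G ` \<C> \<union> anti ` L. (\<Sum>i\<in>I. a i * y i) = 0"
    by (elim exE conjE)
  have yG: "(\<Sum>i\<in>I. G C i * y i) = 0" if "C \<in> \<C>" for C
    by (rule bspec[OF y UnI1[OF imageI[OF that]]])
  have y_anti: "(\<Sum>i\<in>I. anti l i * y i) = 0" if "l \<in> L" for l
    by (rule bspec[OF y UnI2[OF imageI[OF that]]])
  have ysym_lt: "y (p, q) = y (q, p)" if "q < p" "p < r" for p q
  proof -
    have "(\<Sum>i\<in>I. anti (p, q) i * y i) = (\<Sum>i\<in>I. (if i = (p, q) then y i else 0) - (if i = (q, p) then y i else 0))"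
    proof (intro sum.cong refl)
      fix i
      have "q \<noteq> p" "p \<noteq> q" using that by auto
      then show "anti (p, q) i * y i = (if i = (p, q) then y i else 0) - (if i = (q, p) then y i else 0)"
        by (simp add: anti_def)
    qed
    also have "\<dots> = y (p, q) - y (q, p)"
    proof -
      have "finite I" "(p, q) \<in> I" "(q, p) \<in> I" using that by (auto simp: I_def)
      then show ?thesis by (simp add: sum_subtractf)
    qed
    finally show ?thesis using y_anti[of "(p, q)"] that by (simp add: L_def)
  qed
  have ysym: "y (p, q) = y (q, p)" if "p < r" "q < r" for p q
    using that ysym_lt[of p q] ysym_lt[of q p] by (metis linorder_neqE_nat)
  define E where "E = mat r r y"
  have Ec: "E \<in> carrier_mat r r" by (simp add: E_def)
  have Esym: "transpose_mat E = E" using ysym by (intro eq_matI) (auto simp: E_def)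
  have E0: "E \<noteq> 0\<^sub>m r r"
  proof
    assume "E = 0\<^sub>m r r"
    then have "E $$ (i, j) = 0" if "i < r" "j < r" for i j using that by simp
    then show False using y_nz by (auto simp: E_def I_def)
  qed
  define D where "D = W * E * transpose_mat W"
  have Dc: "D \<in> carrier_mat N N" using Wc Ec by (simp add: D_def)
  have pencil: "X + s \<cdot>\<^sub>m D = W * (1\<^sub>m r + s \<cdot>\<^sub>m E) * transpose_mat W" for s
  proof -
    have "W * (1\<^sub>m r + s \<cdot>\<^sub>m E) = W + s \<cdot>\<^sub>m (W * E)"
      using Wc Ec by (simp add: mult_add_distrib_mat[of _ N r _ r] mult_smult_distrib[of _ N r _ r])
    then show ?thesis unfolding XW D_def
      using Wc Ec by (simp add: add_mult_distrib_mat[of _ N r _ _ N] mult_smult_assoc_mat[of _ N r _ N]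
          del: assoc_mult_mat)
  qed
  show thesis
  proof -
    obtain \<epsilon> where \<epsilon>: "0 < \<epsilon>" "\<And>s. \<bar>s\<bar> \<le> \<epsilon> \<Longrightarrow> psd r (1\<^sub>m r + s \<cdot>\<^sub>m E)"
      using psd_pencil_near_zero[OF Ec Esym] by blast
    obtain t where t: "psd r (1\<^sub>m r + t \<cdot>\<^sub>m E)" "det (1\<^sub>m r + t \<cdot>\<^sub>m E) = 0"
      using psd_pencil_singular[OF Ec Esym E0] by blast
    have "vec_space.rank r (1\<^sub>m r + t \<cdot>\<^sub>m E) < r"
      using t Ec by (intro vec_space.det_zero_low_rank) auto
    then have "vec_space.rank N (X + t \<cdot>\<^sub>m D) < r"
      unfolding pencil using psd_congruence(2)[OF Wc t(1)] by linarith
    moreover have "mat_inner C D = 0" if "C \<in> \<C>" for C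
    proof -
      have "(\<Sum>i\<in>I. G C i * y i) = (\<Sum>i<r. \<Sum>j<r. G C (i, j) * y (i, j))"
        unfolding I_def sum.cartesian_product by (intro sum.cong) auto
      then show ?thesis
        using yG[OF that] unfolding D_def mat_inner_congruence[OF \<C>[OF that] Wc Ec]
        by (simp add: G_def E_def)
    qed
    ultimately show thesis
      using that[OF Dc _ \<epsilon>(1)] psd_congruence(1)[OF Wc] \<epsilon>(2) t(1) unfolding pencil r_def by blast
  qed
qed

section \<open>Balanced rank-one decompositions\<close>

text \<open>
  The equation is homogeneous in \<open>(c, s)\<close>, and for \<open>s = 1\<close> it is a quadratic equation in \<open>c\<close> whose
  discriminant is positive because \<open>a\<close> and \<open>d\<close> have opposite signs.
\<close>
lemma rotation_kills_form:
  fixes a e d :: real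
  assumes "0 < a" "d < 0"
  obtains c s where "c\<^sup>2 + s\<^sup>2 = 1" "c\<^sup>2 * a + c * s * e + s\<^sup>2 * d = 0"
proof -
  define R where "R = sqrt (e\<^sup>2 - 4 * a * d)"
  have "a * d \<le> 0" using assms by (simp add: mult_le_0_iff)
  then have "0 \<le> e\<^sup>2 - 4 * a * d" using zero_le_power2[of e] by linarith
  then have R: "R\<^sup>2 = e\<^sup>2 - 4 * a * d" by (simp add: R_def)
  \<comment> \<open>The ratio \<open>c / s\<close>.\<close>
  define x where "x = (R - e) / (2 * a)"
  have "4 * a * (a * x\<^sup>2 + e * x + d) = (2 * a * x + e)\<^sup>2 - (e\<^sup>2 - 4 * a * d)"
    by (simp add: power2_eq_square algebra_simps)
  also have "2 * a * x + e = R" using assms by (simp add: x_def)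
  finally have x: "a * x\<^sup>2 + e * x + d = 0" using R assms by simp
  define h where "h = sqrt (x\<^sup>2 + 1)"
  have h: "h\<^sup>2 = x\<^sup>2 + 1" "h \<noteq> 0"
    using add_nonneg_pos[of "x\<^sup>2" 1] by (simp_all add: h_def)
  show thesis
  proof
    show "(x / h)\<^sup>2 + (1 / h)\<^sup>2 = 1"
      unfolding power_divide add_divide_distrib[symmetric] using h(2) by (simp add: h(1)[symmetric])
    have "(x / h)\<^sup>2 * a + (x / h) * (1 / h) * e + (1 / h)\<^sup>2 * d = (a * x\<^sup>2 + e * x + d) / h\<^sup>2"
      using h(2) by (simp add: power_divide add_divide_distrib power2_eq_square mult_ac)
    then show "(x / h)\<^sup>2 * a + (x / h) * (1 / h) * e + (1 / h)\<^sup>2 * d = 0" using x by simp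
  qed
qed

lemma quadratic_form_lincomb:
  fixes C :: "real mat"
  assumes C: "C \<in> carrier_mat N N" and u: "u \<in> carrier_vec N" and v: "v \<in> carrier_vec N"
  shows "(c \<cdot>\<^sub>v u + s \<cdot>\<^sub>v v) \<bullet> (C *\<^sub>v (c \<cdot>\<^sub>v u + s \<cdot>\<^sub>v v))
    = c\<^sup>2 * (u \<bullet> (C *\<^sub>v u)) + c * s * (u \<bullet> (C *\<^sub>v v) + v \<bullet> (C *\<^sub>v u)) + s\<^sup>2 * (v \<bullet> (C *\<^sub>v v))"
proof -
  have "C *\<^sub>v (c \<cdot>\<^sub>v u + s \<cdot>\<^sub>v v) = c \<cdot>\<^sub>v (C *\<^sub>v u) + s \<cdot>\<^sub>v (C *\<^sub>v v)"
    using C u v by (simp add: mult_add_distrib_mat_vec[of _ N N] mult_mat_vec[of _ N N])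
  then show ?thesis
    using C u v by (simp add: scalar_prod_add_distrib[of _ N] add_scalar_prod_distrib[of _ N]
        power2_eq_square algebra_simps)
qed

text \<open>
  Rotating two vectors of a decomposition in their common plane does not change the sum of their
  rank-one matrices. As long as some vector has a positive value of the form, another one has a
  negative value, and a rotation of this pair gives one of them the value zero. Hence the number of
  nonzero values drops.
\<close>
lemma gram_balanced:
  assumes "finite J" and C: "C \<in> carrier_mat N N"
    and "\<And>j. j \<in> J \<Longrightarrow> w j \<in> carrier_vec N"
    and "mat_inner C (gram N J w) \<le> 0"
  shows "\<exists>w'. (\<forall>j\<in>J. w' j \<in> carrier_vec N \<and> w' j \<bullet> (C *\<^sub>v w' j) \<le> 0) \<and> gram N J w' = gram N J w"
  using assms(3,4)
proof (induction "card {j\<in>J. w j \<bullet> (C *\<^sub>v w j) \<noteq> 0}" arbitrary: w rule: less_induct)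
  case less
  define Q where "Q w = w \<bullet> (C *\<^sub>v w)" for w
  have sum: "(\<Sum>j\<in>J. Q (w j)) \<le> 0"
    using less.prems mat_inner_gram[OF C, of J w] by (simp add: Q_def)
  show ?case
  proof (cases "\<exists>k\<in>J. 0 < Q (w k)")
    case False
    then show ?thesis using less.prems(1) unfolding Q_def by (intro exI[of _ w]) force
  next
    case True
    then obtain k where k: "k \<in> J" "0 < Q (w k)" by blast
    have "\<exists>l\<in>J. Q (w l) < 0"
    proof (rule ccontr)
      assume "\<not> ?thesis"
      then have "Q (w k) \<le> (\<Sum>j\<in>J. Q (w j))"
        using k \<open>finite J\<close> by (intro member_le_sum) force+
      then show False using sum k by simp
    qed
    then obtain l where l: "l \<in> J" "Q (w l) < 0" by blast
    then have kl: "k \<noteq> l" using k by auto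
    note wc = less.prems(1)[OF k(1)] less.prems(1)[OF l(1)]
    obtain c s where cs: "c\<^sup>2 + s\<^sup>2 = 1"
      "c\<^sup>2 * Q (w k) + c * s * (w k \<bullet> (C *\<^sub>v w l) + w l \<bullet> (C *\<^sub>v w k)) + s\<^sup>2 * Q (w l) = 0"
      using rotation_kills_form[OF k(2) l(2)] by metis
    define w' where "w' = w(k := c \<cdot>\<^sub>v w k + s \<cdot>\<^sub>v w l, l := (- s) \<cdot>\<^sub>v w k + c \<cdot>\<^sub>v w l)"
    have w': "w' k = c \<cdot>\<^sub>v w k + s \<cdot>\<^sub>v w l" "w' l = (- s) \<cdot>\<^sub>v w k + c \<cdot>\<^sub>v w l"
      "\<And>j. j \<noteq> k \<Longrightarrow> j \<noteq> l \<Longrightarrow> w' j = w j"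
      using kl by (auto simp: w'_def)
    have w'c: "w' j \<in> carrier_vec N" if "j \<in> J" for j
      using less.prems(1)[OF that] wc by (simp add: w'_def)
    have Qk: "Q (w' k) = 0"
      unfolding Q_def w' quadratic_form_lincomb[OF C wc] using cs(2) by (simp add: Q_def)
    have gram: "gram N J w' = gram N J w"
    proof (intro eq_matI)
      fix p q assume "p < dim_row (gram N J w)" "q < dim_col (gram N J w)"
      then have pq: "p < N" "q < N" by (simp_all add: gram_def)
      define J' where "J' = J - {k, l}"
      have J: "J = insert k (insert l J')" "finite J'" "k \<notin> insert l J'" "l \<notin> J'"
        using k l kl \<open>finite J\<close> by (auto simp: J'_def)
      have rest: "(\<Sum>j\<in>J'. w' j $ p * w' j $ q) = (\<Sum>j\<in>J'. w j $ p * w j $ q)"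
        using w'(3) by (intro sum.cong) (auto simp: J'_def)
      have "w' k $ p * w' k $ q + w' l $ p * w' l $ q
          = (c\<^sup>2 + s\<^sup>2) * (w k $ p * w k $ q + w l $ p * w l $ q)"
        using pq wc by (simp add: w' power2_eq_square algebra_simps)
      then have "w' k $ p * w' k $ q + w' l $ p * w' l $ q = w k $ p * w k $ q + w l $ p * w l $ q"
        using cs(1) by simp
      then show "gram N J w' $$ (p, q) = gram N J w $$ (p, q)"
        using pq J rest by (simp add: gram_def)
    qed (simp_all add: gram_def)
    have "{j\<in>J. Q (w' j) \<noteq> 0} \<subset> {j\<in>J. Q (w j) \<noteq> 0}"
    proof
      show "{j\<in>J. Q (w' j) \<noteq> 0} \<subseteq> {j\<in>J. Q (w j) \<noteq> 0}"
      proof safe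
        fix j assume "j \<in> J" "Q (w' j) \<noteq> 0" "Q (w j) = 0"
        then show False using Qk k l w'(3)[of j] by (cases "j = k"; cases "j = l") auto
      qed
      show "{j\<in>J. Q (w' j) \<noteq> 0} \<noteq> {j\<in>J. Q (w j) \<noteq> 0}"
      proof
        assume "{j\<in>J. Q (w' j) \<noteq> 0} = {j\<in>J. Q (w j) \<noteq> 0}"
        moreover have "k \<in> {j\<in>J. Q (w j) \<noteq> 0}" using k by simp
        ultimately have "k \<in> {j\<in>J. Q (w' j) \<noteq> 0}" by blast
        then show False using Qk by simp
      qed
    qed
    then have "card {j\<in>J. Q (w' j) \<noteq> 0} < card {j\<in>J. Q (w j) \<noteq> 0}"
      using \<open>finite J\<close> by (intro psubset_card_mono) auto
    then obtain w'' where "\<forall>j\<in>J. w'' j \<in> carrier_vec N \<and> w'' j \<bullet> (C *\<^sub>v w'' j) \<le> 0"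
      "gram N J w'' = gram N J w'"
      using less.hyps[of w'] w'c less.prems(2) gram unfolding Q_def by auto
    then show ?thesis using gram by metis
  qed
qed

section \<open>The data of the problem as quadratic forms\<close>

lemma scalar_prod_self: "v \<bullet> v = (vnorm v)\<^sup>2"
  by (simp add: vnorm_def scalar_prod_def sum_nonneg)

lemma append_singleton_split:
  fixes w :: "'a vec"
  assumes "w \<in> carrier_vec (n + 1)"
  shows "vec n (\<lambda>p. w $ p) @\<^sub>v vec 1 (\<lambda>_. w $ n) = w"
  using assms by (intro eq_vecI) (auto simp: less_Suc_eq)

lemma bordered_carrier:
  "M \<in> carrier_mat n n \<Longrightarrow> v \<in> carrier_vec n \<Longrightarrow> bordered M v c \<in> carrier_mat (n + 1) (n + 1)"
  unfolding bordered_def by (metis carrier_vecD four_block_carrier_mat mat_carrier)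

lemma bordered_form:
  assumes M: "M \<in> carrier_mat n n" and v: "v \<in> carrier_vec n" and u: "u \<in> carrier_vec n"
  shows "(u @\<^sub>v vec 1 (\<lambda>_. s)) \<bullet> (bordered M v c *\<^sub>v (u @\<^sub>v vec 1 (\<lambda>_. s)))
    = u \<bullet> (M *\<^sub>v u) + 2 * s * (v \<bullet> u) + c * s\<^sup>2"
proof -
  have B: "mat_of_cols n [v] \<in> carrier_mat n 1" "mat_of_rows n [v] \<in> carrier_mat 1 n"
    by (auto simp: mat_of_cols_def mat_of_rows_def)
  have s: "vec 1 (\<lambda>_. s) \<in> carrier_vec 1" by simp
  have col: "mat_of_cols n [v] *\<^sub>v vec 1 (\<lambda>_. s) = s \<cdot>\<^sub>v v"
    using v by (intro eq_vecI) (auto simp: scalar_prod_def mat_of_cols_def)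
  have row: "mat_of_rows n [v] *\<^sub>v u = vec 1 (\<lambda>_. v \<bullet> u)"
    using v u by (intro eq_vecI) (auto simp: scalar_prod_def mat_of_rows_def intro!: sum.cong)
  have corner: "mat 1 1 (\<lambda>_. c) *\<^sub>v vec 1 (\<lambda>_. s) = vec 1 (\<lambda>_. c * s)"
    by (intro eq_vecI) (auto simp: scalar_prod_def)
  have one: "vec 1 (\<lambda>_. a) \<bullet> vec 1 (\<lambda>_. b) = a * b" for a b :: real
    by (simp add: scalar_prod_def)
  have "bordered M v c *\<^sub>v (u @\<^sub>v vec 1 (\<lambda>_. s))
      = (M *\<^sub>v u + s \<cdot>\<^sub>v v) @\<^sub>v (vec 1 (\<lambda>_. v \<bullet> u) + vec 1 (\<lambda>_. c * s))"
    unfolding bordered_def carrier_vecD[OF v]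
    by (subst four_block_mat_mult_vec[OF M B _ u s]) (simp_all add: col row corner del: One_nat_def)
  then show ?thesis
    using M v u comm_scalar_prod[OF u v]
    by (simp add: scalar_prod_append[of _ n _ 1] scalar_prod_add_distrib[of _ n]
        scalar_prod_add_distrib[of _ 1] one power2_eq_square algebra_simps del: One_nat_def)
qed

lemma constraint_mat_carrier:
  "Fk \<in> carrier_mat dk n \<Longrightarrow> gk \<in> carrier_vec dk \<Longrightarrow> constraint_mat Fk gk \<in> carrier_mat (n + 1) (n + 1)"
  unfolding constraint_mat_def by (intro bordered_carrier) auto

lemma constraint_form:
  assumes F: "Fk \<in> carrier_mat dk n" and g: "gk \<in> carrier_vec dk" and u: "u \<in> carrier_vec n"
  shows "(u @\<^sub>v vec 1 (\<lambda>_. s)) \<bullet> (constraint_mat Fk gk *\<^sub>v (u @\<^sub>v vec 1 (\<lambda>_. s)))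
    = (vnorm (Fk *\<^sub>v u + s \<cdot>\<^sub>v gk))\<^sup>2 - s\<^sup>2"
proof -
  have Fu: "Fk *\<^sub>v u \<in> carrier_vec dk" using F u by simp
  have "u \<bullet> ((transpose_mat Fk * Fk) *\<^sub>v u) = (Fk *\<^sub>v u) \<bullet> (Fk *\<^sub>v u)"
    using transpose_vec_mult_scalar[OF F u Fu] F u Fu
      comm_scalar_prod[of u n "transpose_mat Fk *\<^sub>v (Fk *\<^sub>v u)"]
    by (simp add: assoc_mult_mat_vec[of _ n dk _ n])
  moreover have "(transpose_mat Fk *\<^sub>v gk) \<bullet> u = gk \<bullet> (Fk *\<^sub>v u)"
    by (rule transpose_vec_mult_scalar[OF F u g])
  moreover have "(Fk *\<^sub>v u + s \<cdot>\<^sub>v gk) \<bullet> (Fk *\<^sub>v u + s \<cdot>\<^sub>v gk)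
      = (Fk *\<^sub>v u) \<bullet> (Fk *\<^sub>v u) + 2 * s * (gk \<bullet> (Fk *\<^sub>v u)) + s\<^sup>2 * (gk \<bullet> gk)"
    using Fu g comm_scalar_prod[OF Fu g]
    by (simp add: scalar_prod_add_distrib[of _ dk] add_scalar_prod_distrib[of _ dk]
        power2_eq_square algebra_simps)
  ultimately show ?thesis
    unfolding constraint_mat_def using F g
    by (subst bordered_form[OF _ _ u]) (auto simp: scalar_prod_self algebra_simps)
qed

lemma vnorm_nonneg [simp]: "0 \<le> vnorm v"
  by (simp add: vnorm_def scalar_prod_def sum_nonneg)

lemma vnorm_smult: "vnorm (c \<cdot>\<^sub>v v) = \<bar>c\<bar> * vnorm v"
  by (simp add: vnorm_def real_sqrt_mult[symmetric] mult.assoc[symmetric] power2_eq_square[symmetric]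
      flip: real_sqrt_abs)

lemma vnorm_triangle:
  assumes "u \<in> carrier_vec d" "v \<in> carrier_vec d"
  shows "vnorm (u + v) \<le> vnorm u + vnorm v"
proof -
  have L2: "vnorm x = L2_set (($) x) {0..<d}" if "x \<in> carrier_vec d" for x
    using that by (simp add: vnorm_def L2_set_def scalar_prod_def power2_eq_square)
  have "L2_set (($) (u + v)) {0..<d} = L2_set (\<lambda>i. u $ i + v $ i) {0..<d}"
    using assms by (intro L2_set_cong) auto
  then show ?thesis using assms L2_set_triangle_ineq[of "($) u" "($) v" "{0..<d}"] by (simp add: L2)
qed

lemma vnorm_line:
  assumes "a \<in> carrier_vec p" "c \<in> carrier_vec p"
  shows "(vnorm (\<tau> \<cdot>\<^sub>v a + c))\<^sup>2 = \<tau>\<^sup>2 * (a \<bullet> a) + 2 * \<tau> * (a \<bullet> c) + c \<bullet> c"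
  unfolding scalar_prod_self[symmetric] using assms comm_scalar_prod[OF assms]
  by (simp add: scalar_prod_add_distrib[of _ p] add_scalar_prod_distrib[of _ p] power2_eq_square algebra_simps)

lemma ecqp_obj_smult:
  assumes A: "A \<in> carrier_mat n n" and b: "b \<in> carrier_vec n" and x: "x \<in> carrier_vec n"
  shows "ecqp_obj A b (c \<cdot>\<^sub>v x) = c\<^sup>2 * (x \<bullet> (A *\<^sub>v x)) + 2 * c * (b \<bullet> x)"
proof -
  have "A *\<^sub>v (c \<cdot>\<^sub>v x) = c \<cdot>\<^sub>v (A *\<^sub>v x)" using A x by (simp add: mult_mat_vec)
  then show ?thesis using A b x by (simp add: ecqp_obj_def power2_eq_square)
qed

lemma sdp_value_optimal:
  assumes "sdp_optimal n m A b F g X"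
  shows "sdp_value n m A b F g = sdp_obj A b X"
  unfolding sdp_value_def
  using assms by (intro cInf_eq_minimum) (auto simp: sdp_optimal_def)

section \<open>The rounding procedure\<close>

text \<open>
  The rank bound is the least natural number \<open>s\<close> with \<open>(s + 1) (s + 2) \<ge> 2 (m + 2)\<close>; any larger rank
  \<open>r\<close> leaves room for \<open>m + 1\<close> linear constraints on symmetric matrices of size \<open>r\<close>.
\<close>
lemma rank_bound_exceeded:
  assumes "rank_bound m < r"
  shows "2 * (m + 1) < r * (r + 1)"
proof -
  define s where "s = rank_bound m"
  have "(sqrt (8 * real m + 17) - 3) / 2 \<le> real s"
    unfolding s_def rank_bound_def by linarith
  then have "sqrt (8 * real m + 17) \<le> 2 * real s + 3" by simp
  then have "8 * real m + 17 \<le> (2 * real s + 3)\<^sup>2"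
    by (rule sqrt_le_D)
  then have "real (8 * m + 17) \<le> real ((2 * s + 3)\<^sup>2)" by simp
  then have "8 * m + 17 \<le> (2 * s + 3)\<^sup>2" by (simp only: of_nat_le_iff)
  then have "2 * (m + 1) < (s + 1) * (s + 2)" by (simp add: power2_eq_square algebra_simps)
  also have "\<dots> \<le> r * (r + 1)" using assms unfolding s_def by (intro mult_mono) auto
  finally show ?thesis .
qed

context
  fixes n m :: nat and d :: "nat \<Rightarrow> nat"
    and A :: "real mat" and b :: "real vec"
    and F :: "nat \<Rightarrow> real mat" and g :: "nat \<Rightarrow> real vec"
  assumes A: "A \<in> carrier_mat n n"
    and b: "b \<in> carrier_vec n"
    and F: "\<And>k. k \<in> {1..m} \<Longrightarrow> F k \<in> carrier_mat (d k) n"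
    and g: "\<And>k. k \<in> {1..m} \<Longrightarrow> g k \<in> carrier_vec (d k)"
begin

text \<open>
  Take an optimal solution of least rank and suppose that its rank exceeds the bound. The constraints
  and the normalization of the corner entry are \<open>m + 1\<close> functionals, so there is a direction along which all of
  them are constant. Both signs of a small step are feasible, hence the objective is constant as well,
  and the step that lowers the rank leads to another optimal solution.
\<close>
lemma sdp_low_rank_optimal:
  assumes "\<exists>X. sdp_optimal n m A b F g X"
  shows "\<exists>X. sdp_optimal n m A b F g X \<and> vec_space.rank (n + 1) X \<le> rank_bound m"
proof -
  obtain X where X: "sdp_optimal n m A b F g X"
    and least: "\<And>Y. sdp_optimal n m A b F g Y \<Longrightarrow> vec_space.rank (n + 1) X \<le> vec_space.rank (n + 1) Y"
    using assms ex_has_least_nat[of "sdp_optimal n m A b F g" _ "vec_space.rank (n + 1)"] by blast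
  have "vec_space.rank (n + 1) X \<le> rank_bound m"
  proof (rule ccontr)
    assume "\<not> ?thesis"
    then have count: "2 * (m + 1) < vec_space.rank (n + 1) X * (vec_space.rank (n + 1) X + 1)"
      by (intro rank_bound_exceeded) simp
    have feas: "psd (n + 1) X" "X $$ (n, n) = 1"
      "\<And>k. k \<in> {1..m} \<Longrightarrow> mat_inner (constraint_mat (F k) (g k)) X \<le> 0"
      using X by (auto simp: sdp_optimal_def sdp_feasible_def)
    have Xc: "X \<in> carrier_mat (n + 1) (n + 1)" using feas by (simp add: psd_def)
    \<comment> \<open>The functional that reads off the corner entry.\<close>
    define E where "E = mat (n + 1) (n + 1) (\<lambda>(p, q). if p = n \<and> q = n then 1 else 0 :: real)"
    have Ec: "E \<in> carrier_mat (n + 1) (n + 1)" by (simp add: E_def)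
    have E: "mat_inner E Y = Y $$ (n, n)" for Y
    proof -
      have "mat_inner E Y = (\<Sum>p<n+1. \<Sum>q<n+1. if p = n \<and> q = n then Y $$ (p, q) else 0)"
        by (simp add: mat_inner_def E_def if_distrib[of "\<lambda>x. x * _"] cong: if_cong)
      also have "\<dots> = Y $$ (n, n)" by simp
      finally show ?thesis .
    qed
    define \<C> where "\<C> = insert E ((\<lambda>k. constraint_mat (F k) (g k)) ` {1..m})"
    have "card \<C> \<le> m + 1"
      using card_insert_le_m1[of "m + 1"] card_image_le[of "{1..m}" "\<lambda>k. constraint_mat (F k) (g k)"]
      by (simp add: \<C>_def card_insert_if)
    then have "2 * card \<C> < vec_space.rank (n + 1) X * (vec_space.rank (n + 1) X + 1)"
      by (rule le_less_trans[OF mult_le_mono2 count])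
    moreover have \<C>c: "C \<in> carrier_mat (n + 1) (n + 1)" if "C \<in> \<C>" for C
      using that Ec constraint_mat_carrier[OF F g] by (auto simp: \<C>_def)
    moreover have "finite \<C>" by (simp add: \<C>_def)
    ultimately obtain D \<epsilon> t where D: "D \<in> carrier_mat (n + 1) (n + 1)"
      and D0: "\<And>C. C \<in> \<C> \<Longrightarrow> mat_inner C D = 0"
      and \<epsilon>: "0 < \<epsilon>" "\<And>s. \<bar>s\<bar> \<le> \<epsilon> \<Longrightarrow> psd (n + 1) (X + s \<cdot>\<^sub>m D)"
      and t: "psd (n + 1) (X + t \<cdot>\<^sub>m D)"
        "vec_space.rank (n + 1) (X + t \<cdot>\<^sub>m D) < vec_space.rank (n + 1) X"
      using psd_rank_reduction[OF feas(1), of \<C>] by metis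
    have same: "mat_inner C (X + s \<cdot>\<^sub>m D) = mat_inner C X" if "C \<in> \<C>" for C s
      using mat_inner_add_smult[OF \<C>c[OF that] Xc D, of s] D0[OF that] by simp
    have feasible: "sdp_feasible n m F g (X + s \<cdot>\<^sub>m D)" if "psd (n + 1) (X + s \<cdot>\<^sub>m D)" for s
      using that feas same[of E s] same[of "constraint_mat (F _) (g _)" s]
      unfolding sdp_feasible_def E by (auto simp: \<C>_def)
    have obj: "sdp_obj A b (X + s \<cdot>\<^sub>m D) = sdp_obj A b X + s * sdp_obj A b D" for s
      unfolding sdp_obj_def by (rule mat_inner_add_smult[OF bordered_carrier[OF A b] Xc D])
    have "0 \<le> s * sdp_obj A b D" if "\<bar>s\<bar> \<le> \<epsilon>" for s
      using X feasible[OF \<epsilon>(2)[OF that]] obj[of s] unfolding sdp_optimal_def by fastforce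
    from this[of \<epsilon>] this[of "- \<epsilon>"] have "sdp_obj A b D = 0"
      using \<epsilon>(1) by (simp add: zero_le_mult_iff mult_le_0_iff)
    then have "sdp_optimal n m A b F g (X + t \<cdot>\<^sub>m D)"
      using X feasible[OF t(1)] obj[of t] by (simp add: sdp_optimal_def)
    then show False using least t(2) by fastforce
  qed
  then show ?thesis using X by blast
qed

lemma sdp_gram:
  fixes u :: "nat \<Rightarrow> real vec" and t :: "nat \<Rightarrow> real"
  assumes u: "\<And>j. j \<in> J \<Longrightarrow> u j \<in> carrier_vec n"
    and X: "X = gram (n + 1) J (\<lambda>j. u j @\<^sub>v vec 1 (\<lambda>_. t j))"
  shows gram_corner: "X $$ (n, n) = (\<Sum>j\<in>J. (t j)\<^sup>2)"
    and gram_bordered: "mat_inner (bordered A b c) X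
      = (\<Sum>j\<in>J. u j \<bullet> (A *\<^sub>v u j) + 2 * t j * (b \<bullet> u j) + c * (t j)\<^sup>2)"
    and gram_constraint: "k \<in> {1..m} \<Longrightarrow> mat_inner (constraint_mat (F k) (g k)) X
      = (\<Sum>j\<in>J. (vnorm (F k *\<^sub>v u j + t j \<cdot>\<^sub>v g k))\<^sup>2 - (t j)\<^sup>2)"
proof -
  have w: "u j @\<^sub>v vec 1 (\<lambda>_. t j) \<in> carrier_vec (n + 1)" if "j \<in> J" for j
    by (intro append_carrier_vec u that) simp
  have "(u j @\<^sub>v vec 1 (\<lambda>_. t j)) $ n = t j" if "j \<in> J" for j
    using u[OF that] by simp
  then show "X $$ (n, n) = (\<Sum>j\<in>J. (t j)\<^sup>2)"
    unfolding X gram_def by (auto simp: power2_eq_square intro!: sum.cong)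
  show "mat_inner (bordered A b c) X
      = (\<Sum>j\<in>J. u j \<bullet> (A *\<^sub>v u j) + 2 * t j * (b \<bullet> u j) + c * (t j)\<^sup>2)"
    unfolding X
    by (subst mat_inner_gram[OF bordered_carrier[OF A b]], erule w)
      (intro sum.cong refl bordered_form[OF A b u])
  assume k: "k \<in> {1..m}"
  show "mat_inner (constraint_mat (F k) (g k)) X
      = (\<Sum>j\<in>J. (vnorm (F k *\<^sub>v u j + t j \<cdot>\<^sub>v g k))\<^sup>2 - (t j)\<^sup>2)"
    unfolding X
    by (subst mat_inner_gram[OF constraint_mat_carrier[OF F[OF k] g[OF k]]], erule w)
      (intro sum.cong refl constraint_form[OF F[OF k] g[OF k] u])
qed

text \<open>
  Each constraint is a quadratic inequality in \<open>\<tau>\<close>, so the admissible steps form a compact set; it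
  contains 0 because \<open>\<parallel>g\<^sup>k\<parallel> < 1\<close>.
\<close>
lemma max_step_exists:
  assumes g_less: "\<And>k. k \<in> {1..m} \<Longrightarrow> vnorm (g k) < 1"
    and x: "x \<in> carrier_vec n"
    and T: "T = {\<tau> \<in> {0..1}. \<forall>k \<in> {1..m}. (vnorm (\<tau> \<cdot>\<^sub>v (F k *\<^sub>v x) + g k))\<^sup>2 \<le> 1}"
  shows "\<exists>\<tau>\<in>T. \<forall>\<sigma>\<in>T. \<sigma> \<le> \<tau>"
proof (rule compact_attains_sup)
  have Fx: "F k *\<^sub>v x \<in> carrier_vec (d k)" if "k \<in> {1..m}" for k using F[OF that] x by simp
  have "T = {0..1} \<inter> (\<Inter>k\<in>{1..m}. {\<tau>. \<tau>\<^sup>2 * ((F k *\<^sub>v x) \<bullet> (F k *\<^sub>v x)) + 2 * \<tau> * ((F k *\<^sub>v x) \<bullet> g k) + g k \<bullet> g k \<le> 1})"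
    unfolding T using vnorm_line[OF Fx g] by auto
  moreover have "closed (\<Inter>k\<in>{1..m}. {\<tau>. \<tau>\<^sup>2 * ((F k *\<^sub>v x) \<bullet> (F k *\<^sub>v x)) + 2 * \<tau> * ((F k *\<^sub>v x) \<bullet> g k) + g k \<bullet> g k \<le> 1})"
    by (intro closed_INT ballI closed_Collect_le continuous_intros)
  ultimately show "compact T" by auto
  have "(vnorm (0 \<cdot>\<^sub>v (F k *\<^sub>v x) + g k))\<^sup>2 \<le> 1" if k: "k \<in> {1..m}" for k
  proof -
    have "(vnorm (0 \<cdot>\<^sub>v (F k *\<^sub>v x) + g k))\<^sup>2 = (vnorm (g k))\<^sup>2"
      unfolding vnorm_line[OF Fx[OF k] g[OF k]] by (simp add: scalar_prod_self)
    then show ?thesis using g_less[OF k] by (simp add: power_le_one)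
  qed
  then show "T \<noteq> {}" unfolding T by fastforce
qed

text \<open>
  The crucial point is the index: the corner entry gives \<open>\<Sum>\<^sub>j t\<^sub>j\<^sup>2 = 1\<close>, so some \<open>t\<^sub>i\<^sup>2\<close> is at least the
  average \<open>1 / r\<close>. The constraint \<open>B\<^sup>k \<bullet> X \<le> 0\<close> reads \<open>\<Sum>\<^sub>j \<parallel>F\<^sup>k u\<^sub>j + t\<^sub>j g\<^sup>k\<parallel>\<^sup>2 \<le> 1\<close>, so each
  summand is at most 1, and dividing the one at \<open>i\<close> by \<open>t\<^sub>i\<^sup>2\<close> costs at most a factor \<open>r\<close>.
\<close>
lemma construction_exists:
  assumes g_less: "\<And>k. k \<in> {1..m} \<Longrightarrow> vnorm (g k) < 1"
    and solvable: "\<exists>X. sdp_optimal n m A b F g X"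
  shows "\<exists>X u t i xbar tau. construction n m A b F g X u t i xbar tau"
proof -
  obtain X where X: "sdp_optimal n m A b F g X" "vec_space.rank (n + 1) X \<le> rank_bound m"
    using sdp_low_rank_optimal[OF solvable] by blast
  define r where "r = vec_space.rank (n + 1) X"
  define v where "v = sdp_value n m A b F g"
  have feas: "psd (n + 1) X" "X $$ (n, n) = 1"
    "\<And>k. k \<in> {1..m} \<Longrightarrow> mat_inner (constraint_mat (F k) (g k)) X \<le> 0"
    using X by (auto simp: sdp_optimal_def sdp_feasible_def)
  have split: "w = vec n (\<lambda>p. w $ p) @\<^sub>v vec 1 (\<lambda>_. w $ n)" if "w \<in> carrier_vec (n + 1)" for w :: "real vec"
    using append_singleton_split[OF that] by simp
  obtain w0 where w0: "\<And>j. w0 j \<in> carrier_vec (n + 1)" "X = gram (n + 1) {1..r} w0"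
    using psd_rank_gram[OF feas(1)] unfolding r_def by blast
  have "mat_inner (bordered A b (- v)) X = 0"
  proof -
    have "X = gram (n + 1) {1..r} (\<lambda>j. vec n (\<lambda>p. w0 j $ p) @\<^sub>v vec 1 (\<lambda>_. w0 j $ n))"
      using w0 split by simp
    note forms = sdp_gram[OF _ this]
    have "mat_inner (bordered A b (- v)) X = mat_inner (bordered A b 0) X - v * X $$ (n, n)"
      by (simp add: forms sum.distrib sum_subtractf sum_distrib_left)
    also have "mat_inner (bordered A b 0) X = v"
      using sdp_value_optimal[OF X(1)] unfolding v_def sdp_obj_def by simp
    finally show ?thesis using feas(2) by simp
  qed
  then have "mat_inner (bordered A b (- v)) (gram (n + 1) {1..r} w0) \<le> 0"
    using w0(2) by simp
  from gram_balanced[OF finite_atLeastAtMost bordered_carrier[OF A b] w0(1) this]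
  obtain w where w_all: "\<forall>j\<in>{1..r}. w j \<in> carrier_vec (n + 1) \<and> w j \<bullet> (bordered A b (- v) *\<^sub>v w j) \<le> 0"
    and wX: "gram (n + 1) {1..r} w = X"
    unfolding w0(2)[symmetric] by blast
  have w: "w j \<in> carrier_vec (n + 1)" "w j \<bullet> (bordered A b (- v) *\<^sub>v w j) \<le> 0" if "j \<in> {1..r}" for j
    using w_all that by auto
  define u where "u j = vec n (\<lambda>p. w j $ p)" for j
  define t where "t j = w j $ n" for j
  have u: "u j \<in> carrier_vec n" for j by (simp add: u_def)
  have wut: "u j @\<^sub>v vec 1 (\<lambda>_. t j) = w j" if "j \<in> {1..r}" for j
    using split[OF w(1)[OF that]] by (simp add: u_def t_def)
  have Xut: "X = gram (n + 1) {1..r} (\<lambda>j. u j @\<^sub>v vec 1 (\<lambda>_. t j))"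
    unfolding wX[symmetric] gram_def using wut by (auto intro!: eq_matI sum.cong)
  note forms = sdp_gram[OF u Xut]
  have sum1: "(\<Sum>j\<in>{1..r}. (t j)\<^sup>2) = 1" using forms(1) feas(2) by simp
  then have r: "0 < r" by (cases r) auto
  have "\<exists>i\<in>{1..r}. 1 / real r \<le> (t i)\<^sup>2"
  proof (rule ccontr)
    assume "\<not> ?thesis"
    then have "(t j)\<^sup>2 < 1 / real r" if "j \<in> {1..r}" for j
      using that by (meson not_le)
    then have "(\<Sum>j\<in>{1..r}. (t j)\<^sup>2) < (\<Sum>j\<in>{1..r}. 1 / real r)"
      using r by (intro sum_strict_mono) auto
    then show False using sum1 r by simp
  qed
  then obtain i where i: "i \<in> {1..r}" "1 / real r \<le> (t i)\<^sup>2" by blast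
  have ti: "t i \<noteq> 0" using i(2) r by auto
  define z where "z = (1 / t i) \<cdot>\<^sub>v u i"
  have z: "z \<in> carrier_vec n" using u by (simp add: z_def)
  have near: "vnorm (F k *\<^sub>v z + g k) \<le> sqrt (real r)" if k: "k \<in> {1..m}" for k
  proof -
    define y where "y = F k *\<^sub>v u i + t i \<cdot>\<^sub>v g k"
    have "(vnorm y)\<^sup>2 \<le> (\<Sum>j\<in>{1..r}. (vnorm (F k *\<^sub>v u j + t j \<cdot>\<^sub>v g k))\<^sup>2)"
      unfolding y_def using i(1) by (intro member_le_sum) auto
    also have "\<dots> \<le> 1"
      using feas(3)[OF k] forms(3)[OF k] sum1 by (simp add: sum_subtractf)
    finally have "(vnorm y)\<^sup>2 \<le> 1" .
    have "F k *\<^sub>v z + g k = (1 / t i) \<cdot>\<^sub>v y"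
      unfolding y_def z_def using F[OF k] g[OF k] u[of i] ti
      by (simp add: mult_mat_vec[of _ "d k" n] smult_add_distrib_vec[of _ "d k"] smult_smult_assoc)
    then have "(vnorm (F k *\<^sub>v z + g k))\<^sup>2 = (vnorm y)\<^sup>2 / (t i)\<^sup>2"
      by (simp add: vnorm_smult power_mult_distrib power_divide)
    also have "\<dots> \<le> 1 / (t i)\<^sup>2"
      using \<open>(vnorm y)\<^sup>2 \<le> 1\<close> by (intro divide_right_mono) auto
    also have "\<dots> \<le> real r" using i(2) r ti by (simp add: field_simps)
    finally show ?thesis by (rule real_le_rsqrt)
  qed
  define xbar where "xbar = (if b \<bullet> z \<le> 0 then z else - z)"
  have "xbar \<in> carrier_vec n" using z by (simp add: xbar_def)
  then obtain tau where tau: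
    "tau \<in> {\<tau> \<in> {0..1}. \<forall>k \<in> {1..m}. (vnorm (\<tau> \<cdot>\<^sub>v (F k *\<^sub>v xbar) + g k))\<^sup>2 \<le> 1}"
    "\<forall>\<sigma> \<in> {\<tau> \<in> {0..1}. \<forall>k \<in> {1..m}. (vnorm (\<tau> \<cdot>\<^sub>v (F k *\<^sub>v xbar) + g k))\<^sup>2 \<le> 1}. \<sigma> \<le> tau"
    using max_step_exists[OF g_less _ refl] by blast
  have "construction n m A b F g X u t i xbar tau"
    unfolding construction_def Let_def r_def[symmetric] v_def[symmetric] z_def[symmetric]
  proof (intro conjI)
    show "X = mat (n + 1) (n + 1) (\<lambda>(p, q). \<Sum>j = 1..r. (u j @\<^sub>v vec 1 (\<lambda>_. t j)) $ p * (u j @\<^sub>v vec 1 (\<lambda>_. t j)) $ q)"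
      using Xut unfolding gram_def .
    show "\<forall>j\<in>{1..r}. (u j @\<^sub>v vec 1 (\<lambda>_. t j)) \<bullet> (bordered A b (- v) *\<^sub>v (u j @\<^sub>v vec 1 (\<lambda>_. t j))) \<le> 0"
      using w(2) wut by simp
  qed (use X u i ti near tau r_def xbar_def in auto)
  then show ?thesis by blast
qed

text \<open>
  The point \<open>x = 0\<close>, lifted to the matrix whose only nonzero entry is the corner, is feasible with objective 0.
\<close>
lemma sdp_value_nonpos:
  assumes g_less: "\<And>k. k \<in> {1..m} \<Longrightarrow> vnorm (g k) < 1"
    and X: "sdp_optimal n m A b F g X"
  shows "sdp_value n m A b F g \<le> 0"
proof -
  define u where "u j = (0\<^sub>v n :: real vec)" for j :: nat
  define t where "t j = (1 :: real)" for j :: nat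
  define Y where "Y = gram (n + 1) {1} (\<lambda>j. u j @\<^sub>v vec 1 (\<lambda>_. t j))"
  have u: "u j \<in> carrier_vec n" for j by (simp add: u_def)
  note forms = sdp_gram[OF u Y_def]
  have "psd (n + 1) Y" unfolding Y_def by (intro psd_gram append_carrier_vec u) simp
  moreover have "mat_inner (constraint_mat (F k) (g k)) Y \<le> 0" if k: "k \<in> {1..m}" for k
  proof -
    have "F k *\<^sub>v 0\<^sub>v n + 1 \<cdot>\<^sub>v g k = g k"
      using F[OF k] g[OF k] by (intro eq_vecI) auto
    then show ?thesis using forms(3)[OF k] g_less[OF k] by (simp add: u_def t_def power_le_one)
  qed
  ultimately have "sdp_feasible n m F g Y"
    using forms(1) by (simp add: sdp_feasible_def t_def)
  moreover have "sdp_obj A b Y = 0"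
    unfolding sdp_obj_def forms(2) using A b by (simp add: u_def)
  ultimately show ?thesis using X sdp_value_optimal[OF X] unfolding sdp_optimal_def by fastforce
qed

text \<open>
  Dividing \<open>w\<^sub>i\<^sup>T B\<^sup>* w\<^sub>i \<le> 0\<close> by \<open>t\<^sub>i\<^sup>2\<close> gives \<open>f z \<le> v\<close>, where \<open>v\<close> is the optimal value, and the sign choice
  only decreases the linear term, so \<open>f xbar \<le> v\<close> and \<open>f (\<tau> xbar) \<le> \<tau>\<^sup>2 v\<close>. As \<open>v \<le> 0\<close>, it remains to bound
  \<open>\<tau>\<close> from below: since \<open>\<parallel>F\<^sup>k xbar\<parallel> \<le> \<parallel>F\<^sup>k z + g\<^sup>k\<parallel> + \<parallel>g\<^sup>k\<parallel> \<le> S\<close> with \<open>S = sqrt rt + \<gamma>\<close>, the triangle inequality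
  shows that \<open>(1 - \<gamma>) / S\<close> is an admissible step.
\<close>
lemma construction_bound:
  assumes m: "1 \<le> m"
    and g_less: "\<And>k. k \<in> {1..m} \<Longrightarrow> vnorm (g k) < 1"
    and gamma: "\<gamma> = Max ((\<lambda>k. vnorm (g k)) ` {1..m})"
    and con: "construction n m A b F g X u t i xbar tau"
  shows "ecqp_feasible n m F g (tau \<cdot>\<^sub>v xbar)"
    and "ecqp_obj A b (tau \<cdot>\<^sub>v xbar)
      \<le> (1 - \<gamma>)\<^sup>2 / (sqrt (real (min (rank_bound m) (n + 1))) + \<gamma>)\<^sup>2 * sdp_value n m A b F g"
proof -
  define r where "r = vec_space.rank (n + 1) X"
  define v where "v = sdp_value n m A b F g"
  define z where "z = (1 / t i) \<cdot>\<^sub>v u i"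
  define T where "T = {\<tau> \<in> {0..1}. \<forall>k \<in> {1..m}. (vnorm (\<tau> \<cdot>\<^sub>v (F k *\<^sub>v xbar) + g k))\<^sup>2 \<le> 1}"
  define rt where "rt = min (rank_bound m) (n + 1)"
  have opt: "sdp_optimal n m A b F g X" and r: "r \<le> rank_bound m"
    and i: "i \<in> {1..r}" and ui: "u i \<in> carrier_vec n" and ti: "t i \<noteq> 0"
    and form: "(u i @\<^sub>v vec 1 (\<lambda>_. t i)) \<bullet> (bordered A b (- v) *\<^sub>v (u i @\<^sub>v vec 1 (\<lambda>_. t i))) \<le> 0"
    and near: "\<And>k. k \<in> {1..m} \<Longrightarrow> vnorm (F k *\<^sub>v z + g k) \<le> sqrt (real r)"
    and xbar: "xbar = (if b \<bullet> z \<le> 0 then z else - z)"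
    and tau: "tau \<in> T" "\<And>\<sigma>. \<sigma> \<in> T \<Longrightarrow> \<sigma> \<le> tau"
    using con unfolding construction_def Let_def r_def[symmetric] v_def[symmetric]
      z_def[symmetric] T_def[symmetric] by auto
  have z: "z \<in> carrier_vec n" using ui by (simp add: z_def)
  have xc: "xbar \<in> carrier_vec n" using z by (simp add: xbar)
  have tau01: "0 \<le> tau" "tau \<le> 1" using tau(1) by (auto simp: T_def)
  have Fs: "F k *\<^sub>v (s \<cdot>\<^sub>v xbar) = s \<cdot>\<^sub>v (F k *\<^sub>v xbar)" if "k \<in> {1..m}" for k s
    using F[OF that] xc by (simp add: mult_mat_vec)
  show "ecqp_feasible n m F g (tau \<cdot>\<^sub>v xbar)"
    using tau(1) xc unfolding ecqp_feasible_def T_def by (simp add: Fs)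
  have "X \<in> carrier_mat (n + 1) (n + 1)"
    using opt by (simp add: sdp_optimal_def sdp_feasible_def psd_def)
  then have "r \<le> n + 1" unfolding r_def by (rule vec_space.rank_le_nc)
  then have rt: "r \<le> rt" "1 \<le> rt" using r i by (auto simp: rt_def)
  have \<gamma>: "vnorm (g k) \<le> \<gamma>" if "k \<in> {1..m}" for k
    unfolding gamma using that by (intro Max_ge) auto
  have "\<gamma> \<in> (\<lambda>k. vnorm (g k)) ` {1..m}" unfolding gamma using m by (intro Max_in) auto
  then have \<gamma>01: "0 \<le> \<gamma>" "\<gamma> < 1" using g_less by auto
  define S where "S = sqrt (real rt) + \<gamma>"
  have S: "1 \<le> S" using rt \<gamma>01 by (simp add: S_def add_increasing2)
  have FS: "vnorm (F k *\<^sub>v xbar) \<le> S" if k: "k \<in> {1..m}" for k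
  proof -
    have Fz: "F k *\<^sub>v z \<in> carrier_vec (d k)" using F[OF k] z by simp
    have "F k *\<^sub>v (- z) = (-1) \<cdot>\<^sub>v (F k *\<^sub>v z)"
      using F[OF k] z by (intro eq_vecI) (auto simp: scalar_prod_def sum_negf)
    then have "vnorm (F k *\<^sub>v xbar) = vnorm (F k *\<^sub>v z)" by (simp add: xbar vnorm_smult)
    also have "F k *\<^sub>v z = (F k *\<^sub>v z + g k) + (-1) \<cdot>\<^sub>v g k"
      using F[OF k] Fz g[OF k] by (intro eq_vecI) auto
    also have "vnorm \<dots> \<le> vnorm (F k *\<^sub>v z + g k) + vnorm ((-1) \<cdot>\<^sub>v g k)"
      using Fz g[OF k] by (intro vnorm_triangle[of _ "d k"]) auto
    also have "\<dots> \<le> sqrt (real r) + \<gamma>" using near[OF k] \<gamma>[OF k] by (simp add: vnorm_smult)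
    also have "\<dots> \<le> S" using rt by (simp add: S_def)
    finally show ?thesis .
  qed
  define \<tau>0 where "\<tau>0 = (1 - \<gamma>) / S"
  have \<tau>0: "0 \<le> \<tau>0" "\<tau>0 \<le> 1" "\<tau>0 * S + \<gamma> = 1" using S \<gamma>01 by (auto simp: \<tau>0_def)
  have "\<tau>0 \<in> T"
  proof -
    have "(vnorm (\<tau>0 \<cdot>\<^sub>v (F k *\<^sub>v xbar) + g k))\<^sup>2 \<le> 1" if k: "k \<in> {1..m}" for k
    proof -
      have "vnorm (\<tau>0 \<cdot>\<^sub>v (F k *\<^sub>v xbar) + g k) \<le> vnorm (\<tau>0 \<cdot>\<^sub>v (F k *\<^sub>v xbar)) + vnorm (g k)"
        using F[OF k] g[OF k] xc by (intro vnorm_triangle[of _ "d k"]) auto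
      also have "\<dots> \<le> \<tau>0 * S + \<gamma>"
        using \<tau>0(1) FS[OF k] \<gamma>[OF k] by (simp add: vnorm_smult add_mono mult_left_mono)
      finally show ?thesis using \<tau>0(3) by (simp add: power_le_one)
    qed
    then show ?thesis using \<tau>0 by (simp add: T_def)
  qed
  then have \<tau>0_le: "\<tau>0 \<le> tau" by (rule tau(2))
  have v: "v \<le> 0" unfolding v_def by (rule sdp_value_nonpos[OF g_less opt])
  define q where "q = z \<bullet> (A *\<^sub>v z)"
  define \<beta> where "\<beta> = b \<bullet> xbar"
  have \<beta>: "\<beta> \<le> 0" "\<beta> \<le> b \<bullet> z" using b z by (auto simp: \<beta>_def xbar)
  have qx: "xbar \<bullet> (A *\<^sub>v xbar) = q"
  proof -
    have "A *\<^sub>v (- z) = - (A *\<^sub>v z)" using A z by (intro eq_vecI) (auto simp: scalar_prod_def sum_negf)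
    then show ?thesis using A z by (simp add: xbar q_def)
  qed
  have zv: "q + 2 * (b \<bullet> z) \<le> v"
  proof -
    have "u i = t i \<cdot>\<^sub>v z" using ti by (simp add: z_def smult_smult_assoc)
    then have "(t i)\<^sup>2 * (q + 2 * (b \<bullet> z) - v) \<le> 0"
      using form unfolding bordered_form[OF A b ui] using A b z
      by (simp add: mult_mat_vec[of _ n n] q_def power2_eq_square algebra_simps)
    then show ?thesis using ti by (simp add: mult_le_0_iff)
  qed
  have "ecqp_obj A b (tau \<cdot>\<^sub>v xbar) = tau\<^sup>2 * q + 2 * tau * \<beta>"
    unfolding ecqp_obj_smult[OF A b xc] qx \<beta>_def ..
  also have "\<dots> \<le> tau\<^sup>2 * q + 2 * (tau\<^sup>2 * \<beta>)"
  proof -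
    have "tau\<^sup>2 \<le> tau" using tau01 by (simp add: power2_eq_square mult_left_le)
    then have "tau * \<beta> \<le> tau\<^sup>2 * \<beta>" using \<beta>(1) by (intro mult_right_mono_neg)
    then show ?thesis by simp
  qed
  also have "\<dots> = tau\<^sup>2 * (q + 2 * \<beta>)" by (simp add: algebra_simps)
  also have "\<dots> \<le> tau\<^sup>2 * v" using zv \<beta>(2) by (intro mult_left_mono) auto
  also have "\<dots> \<le> \<tau>0\<^sup>2 * v"
    using v \<tau>0_le \<tau>0(1) by (intro mult_right_mono_neg power_mono)
  also have "\<dots> = (1 - \<gamma>)\<^sup>2 / S\<^sup>2 * v" by (simp add: \<tau>0_def power_divide)
  finally show "ecqp_obj A b (tau \<cdot>\<^sub>v xbar)
      \<le> (1 - \<gamma>)\<^sup>2 / (sqrt (real (min (rank_bound m) (n + 1))) + \<gamma>)\<^sup>2 * sdp_value n m A b F g"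
    unfolding S_def rt_def v_def .
qed

end

theorem theorem6:
  fixes n m :: nat and d :: "nat \<Rightarrow> nat"
    and A :: "real mat" and b :: "real vec"
    and F :: "nat \<Rightarrow> real mat" and g :: "nat \<Rightarrow> real vec"
    and \<gamma> :: real and rt :: nat
  assumes m: "1 \<le> m"
    and A: "A \<in> carrier_mat n n" "transpose_mat A = A"
    and b: "b \<in> carrier_vec n"
    and d: "\<And>k. k \<in> {1..m} \<Longrightarrow> 1 \<le> d k"
    and F: "\<And>k. k \<in> {1..m} \<Longrightarrow> F k \<in> carrier_mat (d k) n"
    and g: "\<And>k. k \<in> {1..m} \<Longrightarrow> g k \<in> carrier_vec (d k)"
    and g_less: "\<And>k. k \<in> {1..m} \<Longrightarrow> vnorm (g k) < 1"
    and solvable: "\<exists>X. sdp_optimal n m A b F g X"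
    and gamma: "\<gamma> = Max ((\<lambda>k. vnorm (g k)) ` {1..m})"
    and rt: "rt = min (rank_bound m) (n + 1)"
  shows "(\<exists>X u t i xbar tau. construction n m A b F g X u t i xbar tau) \<and>
    (\<forall>X u t i xbar tau. construction n m A b F g X u t i xbar tau \<longrightarrow>
       ecqp_feasible n m F g (tau \<cdot>\<^sub>v xbar) \<and>
       ecqp_obj A b (tau \<cdot>\<^sub>v xbar)
         \<le> (1 - \<gamma>)\<^sup>2 / (sqrt (real rt) + \<gamma>)\<^sup>2 * sdp_value n m A b F g)"
proof (intro conjI allI impI)
  show "\<exists>X u t i xbar tau. construction n m A b F g X u t i xbar tau"
    by (rule construction_exists[OF A(1) b F g g_less solvable])
next
  fix X u t i xbar tau
  assume con: "construction n m A b F g X u t i xbar tau"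
  show "ecqp_feasible n m F g (tau \<cdot>\<^sub>v xbar)"
    by (rule construction_bound(1)[OF A(1) b F g m g_less gamma con])
  show "ecqp_obj A b (tau \<cdot>\<^sub>v xbar)
      \<le> (1 - \<gamma>)\<^sup>2 / (sqrt (real rt) + \<gamma>)\<^sup>2 * sdp_value n m A b F g"
    unfolding rt by (rule construction_bound(2)[OF A(1) b F g m g_less gamma con])
qed

end
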